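(* Let $m,n\ge 1$ be integers with $\gcd(m,n)=1$, let $\theta=\frac mn$, and let $\alpha>m-1-\frac mn$ (note $m-1-\frac mn\ge -1$). Let $$\nu_0=0,\qquad \nu_i=\frac in\ (1\le i\le n-1),\qquad \nu_i=1-\frac{\alpha}{m}-\frac{i-n+1}{m}\ (n\le i\le m+n-1),$$ and let the constants $b_0,\dots,b_{m+n-1}$ be determined by $\prod_{i=1}^{m+n-1}(x-\nu_i)=\sum_{i=0}^{m+n-1}b_ix^i$, that is, $b_i=(-1)^{m+n-1-i}e_{m+n-1-i}(\nu_1,\dots,\nu_{m+n-1})$ with $e_i$ the elementary symmetric polynomials. Write $\Delta_x=x\frac{d}{dx}$, $\Delta_y=y\frac{d}{dy}$, and define the bilinear concomitants $$\mathcal B(f(x),g(y))=(-1)^{n+1}\sum_{j=0}^{m+n-1}(-1)^j(\Delta_x)^jf(x)\sum_{i=0}^{m+n-1-j}\frac{b_{i+j}}{m^{i+j}}(\Delta_y)^ig(y),$$ $$\widetilde{\mathcal B}(f(x),g(y))=(-1)^{n+1}\sum_{j=0}^{m+n-1}(-1)^j(\Delta_x)^jf(x)\sum_{i=0}^{m+n-1-j}b_{i+j}(\Delta_y)^ig(y).$$ Then, for $x,y>0$ with $x\ne y$, the Wright generalized Bessel kernel $K^{(\alpha,\theta)}$ satisfies $$K^{(\alpha,\frac mn)}(x,y)=m^mn^{n-1}x^{m-1}\,\frac{\mathcal B\Big(x^{\alpha+1-m}J_{\frac{(\alpha+1)n}{m},\frac nm}(x),\;J_{\alpha+1,\frac mn}(y^{\frac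 mn})\Big)}{x^m-y^m}.$$ Equivalently, $$K^{(\alpha,\frac mn)}\big(mn^{\frac nm}x^{\frac1m},mn^{\frac nm}y^{\frac1m}\big)=\frac{x^{1-\frac1m}}{n^{\frac nm}}\,\frac{\widetilde{\mathcal B}\Big(G^{m,0}_{0,m+n}\big({-\atop -\nu_{m+n-1},\dots,-\nu_1,\nu_0}\big|x\big),\;G^{n,0}_{0,m+n}\big({-\atop \nu_0,\nu_1,\dots,\nu_{m+n-1}}\big|y\big)\Big)}{x-y}$$ $$=m^{\alpha}n^{\frac{n\alpha}{m}-1}x^{1-\frac1m}\,\frac{\widetilde{\mathcal B}\Big(x^{\frac{\alpha+1}{m}-1}J_{\frac{(\alpha+1)n}{m},\frac nm}(mn^{\frac nm}x^{\frac1m}),\;J_{\alpha+1,\frac mn}(m^{\frac mn}n\,y^{\frac1n})\Big)}{x-y}.$$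
   Context: Wright's generalized Bessel function: $J_{a,b}(x)=\sum_{j=0}^\infty\frac{(-x)^j}{j!\,\Gamma(a+bj)}$ for $a\in\mathbb C$, $b>-1$ (with $1/\Gamma=0$ at the poles of $\Gamma$). Wright's generalized Bessel kernel: for $\alpha>-1$, $\theta>0$ and $x,y>0$, $$K^{(\alpha,\theta)}(x,y)=\theta x^\alpha\int_0^1J_{\frac{\alpha+1}{\theta},\frac1\theta}(ux)\,J_{\alpha+1,\theta}((uy)^\theta)\,u^\alpha\,du.$$ Meijer G-function (only the case needed): for $1\le k\le q$, real $\beta_1,\dots,\beta_q$ and $z>0$, $$G^{k,0}_{0,q}\Big({-\atop\beta_1,\dots,\beta_q}\Big|z\Big)=\frac1{2\pi i}\int_\gamma\frac{\prod_{j=1}^k\Gamma(\beta_j+u)}{\prod_{j=k+1}^q\Gamma(1-\beta_j-u)}z^{-u}\,du,$$ where $\gamma$ has all poles of $\Gamma(\beta_j+u)$, $j=1,\dots,k$, on its left (it may be taken as a loop starting and ending at $-\infty$ and encircling all these poles once in the positive direction). *)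

theory Defs
  imports "HOL-Complex_Analysis.Complex_Analysis"
begin

(* Wright's generalized Bessel function, for b > -1; the parameter and the argument may be
   real or complex.  rGamma is the entire function 1/Gamma, which vanishes at the poles. *)
definition wright_J :: "'a::Gamma \<Rightarrow> real \<Rightarrow> 'a \<Rightarrow> 'a" where
  "wright_J a b x = (\<Sum>j. (- x) ^ j / fact j * rGamma (a + of_real (b * real j)))"

definition wright_kernel :: "real \<Rightarrow> real \<Rightarrow> real \<Rightarrow> real \<Rightarrow> real" where
  "wright_kernel \<alpha> \<theta> x y =
     \<theta> * x powr \<alpha> *
     integral {0..1} (\<lambda>u. wright_J ((\<alpha> + 1) / \<theta>) (1 / \<theta>) (u * x)
                          * wright_J (\<alpha> + 1) \<theta> ((u * y) powr \<theta>) * u powr \<alpha>)"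

(* For R to infinity this becomes the loop that starts at -infinity - i, crosses the real axis
   upwards at c, and returns to -infinity + i. *)
definition hankel_loop :: "real \<Rightarrow> real \<Rightarrow> real \<Rightarrow> complex" where
  "hankel_loop c R =
     linepath (Complex (- R) (- 1)) (Complex c (- 1)) +++
     linepath (Complex c (- 1)) (Complex c 1) +++
     linepath (Complex c 1) (Complex (- R) 1)"

(* The integrand of G^{k,0}_{0,q}, where q = length bs, and bs ! (j - 1) is beta_j. *)
definition meijer_G_integrand :: "nat \<Rightarrow> real list \<Rightarrow> real \<Rightarrow> complex \<Rightarrow> complex" where
  "meijer_G_integrand k bs z u =
     (\<Prod>j<k. Gamma (of_real (bs ! j) + u)) *
     (\<Prod>j=k..<length bs. rGamma (1 - of_real (bs ! j) - u)) *
     of_real z powr (- u)"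

(* Meant for 1 <= k <= length bs and z > 0.  The poles -beta_j - l (j <= k, l a natural number)
   are real and at most Max (-beta_j), so the loop encircles all of them once, positively. *)
definition meijer_G :: "nat \<Rightarrow> real list \<Rightarrow> real \<Rightarrow> complex" where
  "meijer_G k bs z =
     1 / (2 * of_real pi * \<i>) *
     Lim at_top (\<lambda>R. contour_integral (hankel_loop (1 + Max ((\<lambda>j. - bs ! j) ` {..<k})) R)
                       (meijer_G_integrand k bs z))"

definition nu :: "nat \<Rightarrow> nat \<Rightarrow> real \<Rightarrow> nat \<Rightarrow> real" where
  "nu m n \<alpha> i =
     (if i = 0 then 0
      else if i \<le> n - 1 then real i / real n
      else 1 - \<alpha> / real m - (real i - real n + 1) / real m)"

definition b_coeff :: "nat \<Rightarrow> nat \<Rightarrow> real \<Rightarrow> nat \<Rightarrow> real" where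
  "b_coeff m n \<alpha> i = coeff (\<Prod>l=1..m+n-1. [:- nu m n \<alpha> l, 1:]) i"

lemma prod_nu_eq_sum_b_coeff:
  "(\<Prod>l=1..m+n-1. x - nu m n \<alpha> l) = (\<Sum>i=0..m+n-1. b_coeff m n \<alpha> i * x ^ i)"
proof -
  let ?p = "\<Prod>l=1..m+n-1. [:- nu m n \<alpha> l, 1:]"
  have "degree ?p = m + n - 1"
    by (subst degree_prod_eq_sum_degree) auto
  then have "poly ?p x = (\<Sum>i\<le>m+n-1. b_coeff m n \<alpha> i * x ^ i)"
    by (simp add: poly_altdef b_coeff_def)
  then show ?thesis
    by (simp add: poly_prod atLeast0AtMost)
qed

definition euler_op :: "(real \<Rightarrow> 'a::real_normed_vector) \<Rightarrow> real \<Rightarrow> 'a" where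
  "euler_op f = (\<lambda>x. x *\<^sub>R vector_derivative f (at x))"

(* The bilinear concomitant of f and g, written B(f(x), g(y)) in the literature: f and g enter as
   functions, because they are differentiated, and x, y are the points of evaluation.  The tilde
   variant lacks the scaling of b_(i+j) by m^(i+j). *)
definition concomitant ::
  "nat \<Rightarrow> nat \<Rightarrow> real \<Rightarrow> (real \<Rightarrow> 'a::real_normed_field) \<Rightarrow> (real \<Rightarrow> 'a) \<Rightarrow> real \<Rightarrow> real \<Rightarrow> 'a" where
  "concomitant m n \<alpha> f g x y =
     (- 1) ^ (n + 1) *
     (\<Sum>j=0..m+n-1. (- 1) ^ j * (euler_op ^^ j) f x *
        (\<Sum>i=0..m+n-1-j. of_real (b_coeff m n \<alpha> (i + j) / real m ^ (i + j)) * (euler_op ^^ i) g y))"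

definition concomitant_tilde ::
  "nat \<Rightarrow> nat \<Rightarrow> real \<Rightarrow> (real \<Rightarrow> 'a::real_normed_field) \<Rightarrow> (real \<Rightarrow> 'a) \<Rightarrow> real \<Rightarrow> real \<Rightarrow> 'a" where
  "concomitant_tilde m n \<alpha> f g x y =
     (- 1) ^ (n + 1) *
     (\<Sum>j=0..m+n-1. (- 1) ^ j * (euler_op ^^ j) f x *
        (\<Sum>i=0..m+n-1-j. of_real (b_coeff m n \<alpha> (i + j)) * (euler_op ^^ i) g y))"

end

(* The factors of the kernel are f(t) = t^(alpha+1-m) J(t) and g(t) = J(t^(m/n)).  Comparing
   coefficients of their power series shows, with Q(s) = sum_i b_i (s/m)^i and D = t d/dt, that
   D Q(D) g = k t^m g and -D Q(-D) f = k t^m f for the same constant k.  Since B is the bilinear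
   concomitant of this adjoint pair, u d/du B(f(ux), g(uy)) telescopes to a constant multiple of
   (x^m - y^m) u^m f(ux) g(uy), which is u times the integrand of the kernel.  The assumption on
   alpha is what makes B(f(ux), g(uy)) vanish as u tends to 0: the constant term of g meets
   Q(-D) f, which annihilates the first m terms of f, and all other products have the exponent at
   least alpha + 1 - m + m/n > 0.  Integrating over u from 0 to 1 gives the first formula, and the
   substitution x -> m n^(n/m) x^(1/m) turns it into the third one.

   For the Meijer G-functions, the multiplication theorem collapses the Gamma products in the
   integrand to a single quotient of Gamma functions.  Closing the Hankel loop halfway between two
   poles, the residues sum up to the Wright functions, because Gamma decays like 1/N! on the left
   edge while 1/Gamma stays bounded on right half strips. *)
theory Submission
  imports Defs "HOL-Real_Asymp.Real_Asymp"
begin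

section \<open>The Gamma function\<close>

text \<open>One polynomial serves both differential equations because of how its roots lie. The nu_i
  together with nu_0 = 0 form two arithmetic progressions, with steps 1/n and 1/m, so X * prod (X -
  nu_i) is, up to constants, a product of two Pochhammer symbols, of lengths n and m. For g, the
  first is a quotient of factorials and the second a quotient of Gamma values; for f, where the
  argument changes its sign, they exchange these roles. That \<theta> is rational enters here: m
  coefficients of f and n coefficients of g both span the exponent m.

  The exponent \<alpha> + 1 - m of f may be negative, so single products in the concomitant may blow
  up at 0. The limit is therefore taken only after the constant term of g has been separated from
  the rest.

  The two G-functions are not normalised individually. Each carries an unknown constant from the
  multiplication theorem, and only the product of both enters the bilinear concomitant.\<close>

lemma pochhammer_mult_of_nat:
  fixes z :: "'a::field_char_0"
  assumes "n > 0"
  shows "pochhammer (of_nat n * z) (n * N) =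
           of_nat n ^ (n * N) * (\<Prod>j<n. pochhammer (z + of_nat j / of_nat n) N)"
proof (induction N)
  case (Suc N)
  have "pochhammer (of_nat n * z) (n * Suc N) =
          pochhammer (of_nat n * z) (n * N) * pochhammer (of_nat n * z + of_nat (n * N)) n"
    by (metis add.commute mult_Suc_right pochhammer_product')
  also have "pochhammer (of_nat n * z + of_nat (n * N)) n =
               (\<Prod>j<n. of_nat n * (z + of_nat j / of_nat n + of_nat N))"
    unfolding pochhammer_prod atLeast0LessThan using assms
    by (intro prod.cong) (auto simp: field_simps)
  finally show ?case
    unfolding Suc.IH by (simp add: prod.distrib power_add pochhammer_Suc mult_ac)
qed auto

text \<open>The value of the constant is irrelevant here: the constants for m and for n cancel in the product
  of the two Meijer G-functions.\<close>
lemma rGamma_multiplication: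
  assumes "n > 0"
  obtains D :: complex where "D \<noteq> 0"
    "\<And>z. (\<Prod>j<n. rGamma (z + of_nat j / of_nat n)) =
           D * exp (of_nat n * z * of_real (ln (real n))) * rGamma (of_nat n * z)"
proof -
  \<comment> \<open>With this \<open>M\<close>, the Pochhammer symbol in
    \<open>rGamma_series (of_nat n * z) (M N)\<close> has length \<open>n * (N + 1)\<close>, which
    is the total length of the \<open>n\<close> Pochhammer symbols on the other side.\<close>
  define M where "M = (\<lambda>N. n * (N + 1) - 1)"
  define A :: "nat \<Rightarrow> complex" where
    "A = (\<lambda>N. fact (M N) / (of_nat n ^ (n * (N + 1)) *
            (\<Prod>j<n. fact N * exp (of_nat j / of_nat n * of_real (ln (real N))))))"
  define e :: "complex \<Rightarrow> nat \<Rightarrow> complex" where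
    "e = (\<lambda>z N. exp (of_nat n * z * of_real (ln (real (M N)) - ln (real N))))"
  have series: "(\<Prod>j<n. rGamma_series (z + of_nat j / of_nat n) N) =
                  A N * (e z N * rGamma_series (of_nat n * z) (M N))" for z :: complex and N
  proof -
    have M1: "M N + 1 = n * (N + 1)" using assms by (simp add: M_def)
    have P: "(\<Prod>j<n. exp ((z + of_nat j / of_nat n) * of_real (ln (real N)))) =
          exp (of_nat n * z * of_real (ln (real N))) * (\<Prod>j<n. exp (of_nat j / of_nat n * complex_of_real (ln (real N))))"
      by (simp add: exp_add ring_distribs prod.distrib mult.assoc exp_of_nat_mult)
    have "rGamma_series (of_nat n * z) (M N) =
        of_nat n ^ (n * (N + 1)) * (\<Prod>j<n. pochhammer (z + of_nat j / of_nat n) (N + 1)) /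
        (fact (M N) * exp (of_nat n * z * of_real (ln (real (M N)))))"
      unfolding rGamma_series_def M1 pochhammer_mult_of_nat[OF assms] by simp
    then show ?thesis
      unfolding rGamma_series_def A_def e_def prod_dividef prod.distrib P
      using assms by (simp add: field_simps exp_diff)
  qed
  have Mlim: "filterlim M at_top sequentially"
    unfolding M_def using assms
    by (intro filterlim_at_top_mono[OF filterlim_ident])
       (auto intro!: always_eventually simp: Suc_le_eq gr0_conv_Suc)
  have "(\<lambda>N. ln (real n * (real N + 1) - 1) - ln (real N)) \<longlonglongrightarrow> ln (real n)"
    using assms by real_asymp
  then have lim_ln: "(\<lambda>N. ln (real (M N)) - ln (real N)) \<longlonglongrightarrow> ln (real n)"
    using assms by (simp add: M_def of_nat_diff algebra_simps Suc_leI trans_le_add1)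
  have lim_e: "e z \<longlonglongrightarrow> exp (of_nat n * z * of_real (ln (real n)))" for z
    unfolding e_def by (intro tendsto_intros lim_ln)
  let ?R = "\<lambda>z. exp (of_nat n * z * of_real (ln (real n))) * rGamma (of_nat n * z) :: complex"
  let ?P = "\<lambda>z::complex. \<Prod>j<n. rGamma (z + of_nat j / of_nat n)"
  have lim_R: "(\<lambda>N. e z N * rGamma_series (of_nat n * z) (M N)) \<longlonglongrightarrow> ?R z" for z
    by (intro tendsto_mult lim_e filterlim_compose[OF rGamma_series_LIMSEQ Mlim])
  have lim_P: "(\<lambda>N. A N * (e z N * rGamma_series (of_nat n * z) (M N))) \<longlonglongrightarrow> ?P z" for z
    unfolding series[symmetric] by (intro tendsto_intros)
  have R1: "?R 1 \<noteq> 0"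
    using assms of_nat_in_nonpos_Ints_iff[where n = n] by (simp add: rGamma_eq_zero_iff)
  have P1: "?P 1 \<noteq> 0"
  proof -
    have "1 + complex_of_nat j / of_nat n \<notin> \<int>\<^sub>\<le>\<^sub>0" for j
    proof -
      have "1 + complex_of_nat j / of_nat n = of_real (1 + real j / real n)" by simp
      moreover have "1 + real j / real n > 0" by (simp add: add_pos_nonneg)
      ultimately show ?thesis
        by (metis of_real_in_nonpos_Ints_iff nonpos_Ints_nonpos not_le)
    qed
    then show ?thesis by (simp add: rGamma_eq_zero_iff)
  qed
  \<comment> \<open>The factor \<open>A N\<close> does not depend on \<open>z\<close>. Its limit can
    be read off at the single point 1, where both limits are nonzero, and then serves every
    \<open>z\<close>.\<close>
  define D where "D = ?P 1 / ?R 1"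
  have "(\<lambda>N. A N * (e 1 N * rGamma_series (of_nat n * 1) (M N)) /
              (e 1 N * rGamma_series (of_nat n * 1) (M N))) \<longlonglongrightarrow> D"
    unfolding D_def by (intro tendsto_divide lim_P lim_R R1)
  moreover have "\<forall>\<^sub>F N in sequentially. e 1 N * rGamma_series (of_nat n * 1) (M N) \<noteq> 0"
    using tendsto_imp_eventually_ne[OF lim_R R1] .
  ultimately have "A \<longlonglongrightarrow> D"
    by (rule Lim_transform_eventually[rotated, rotated, OF _ eventually_mono]) auto
  then have "?P z = D * ?R z" for z
    using LIMSEQ_unique[OF lim_P tendsto_mult[OF _ lim_R]] by blast
  moreover have "D \<noteq> 0" using R1 P1 by (simp add: D_def)
  ultimately show thesis by (intro that[of D]) (auto simp: mult_ac)
qed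

text \<open>Compactness settles the real parts up to 2. Beyond,
  \<open>(z - 1) * rGamma z = rGamma (z - 1)\<close> with \<open>norm (z - 1) \<ge> 1\<close>, so a
  step to the left does not decrease the norm. The left end \<open>min \<sigma> 1\<close> keeps
  \<open>z - 1\<close> in the range of the induction.\<close>

lemma rGamma_bounded_half_strip:
  obtains B where "B > 0"
    "\<And>z::complex. Re z \<ge> \<sigma> \<Longrightarrow> \<bar>Im z\<bar> \<le> \<tau> \<Longrightarrow> norm (rGamma z) \<le> B"
proof -
  have "compact (rGamma ` cbox (Complex (min \<sigma> 1) (-\<tau>)) (Complex 2 \<tau>))"
    by (intro compact_continuous_image continuous_intros) auto
  then obtain B where B: "B > 0" "\<And>z. z \<in> cbox (Complex (min \<sigma> 1) (-\<tau>)) (Complex 2 \<tau>) \<Longrightarrow> norm (rGamma z) \<le> B"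
    by (metis bounded_pos compact_imp_bounded imageI)
  have "norm (rGamma z) \<le> B" if "min \<sigma> 1 \<le> Re z" "\<bar>Im z\<bar> \<le> \<tau>" "Re z \<le> 2 + real k" for z k
    using that
  proof (induction k arbitrary: z)
    case 0
    then show ?case by (intro B) (auto simp: in_cbox_complex_iff)
  next
    case (Suc k)
    show ?case
    proof (cases "Re z \<le> 2")
      case True
      with Suc.prems show ?thesis by (intro B) (auto simp: in_cbox_complex_iff)
    next
      case False
      have "1 * norm (rGamma z) \<le> norm (z - 1) * norm (rGamma z)"
        using False abs_Re_le_cmod[of "z - 1"] by (intro mult_right_mono) auto
      also have "\<dots> = norm (rGamma (z - 1))"
        using rGamma_plus1[of "z - 1"] by (simp flip: norm_mult)
      also have "\<dots> \<le> B" using Suc.prems False by (intro Suc.IH) auto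
      finally show ?thesis by simp
    qed
  qed
  then have "norm (rGamma z) \<le> B" if "Re z \<ge> \<sigma>" "\<bar>Im z\<bar> \<le> \<tau>" for z
    using that real_arch_simple[of "Re z"] by (smt (verit) min.cobounded1)
  with B(1) show thesis by (intro that)
qed

section \<open>Iterated Euler operators and power series with real exponents\<close>

text \<open>All iterates of \<open>euler_op\<close> at once, with their differentiability as part of
  the predicate: \<open>vector_derivative\<close> is meaningful only where a derivative
  exists.\<close>

definition euler_tower :: "(real \<Rightarrow> 'a::real_normed_vector) \<Rightarrow> (nat \<Rightarrow> real \<Rightarrow> 'a) \<Rightarrow> bool" where
  "euler_tower f F \<longleftrightarrow>
     (\<forall>t>0. F 0 t = f t \<and> (\<forall>k. (F k has_vector_derivative F (Suc k) t /\<^sub>R t) (at t)))"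

lemma euler_tower_euler_op:
  assumes "euler_tower f F" "t > 0"
  shows "(euler_op ^^ k) f t = F k t"
  using assms(2)
proof (induction k arbitrary: t)
  case 0
  with assms(1) show ?case by (simp add: euler_tower_def)
next
  case (Suc k)
  have "(F k has_vector_derivative F (Suc k) t /\<^sub>R t) (at t)"
    using assms(1) Suc.prems by (auto simp: euler_tower_def)
  \<comment> \<open>The iterate is known to agree with \<open>F k\<close> only for positive
    arguments, but these form an open set, so the derivatives at \<open>t\<close> coincide.\<close>
  then have "((euler_op ^^ k) f has_vector_derivative F (Suc k) t /\<^sub>R t) (at t)"
    by (rule has_vector_derivative_transform_within_open[OF _ open_greaterThan[of 0]])
       (use Suc in auto)
  from vector_derivative_at[OF this] Suc.prems show ?case
    by (simp add: euler_op_def[of "(euler_op ^^ k) f"])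
qed

lemma euler_tower_cong:
  assumes "\<And>t. t > 0 \<Longrightarrow> f t = g t" "euler_tower f F"
  shows "euler_tower g F"
  using assms by (simp add: euler_tower_def)

lemma euler_tower_real:
  fixes f :: "real \<Rightarrow> real"
  shows "euler_tower f F \<longleftrightarrow>
    (\<forall>t>0. F 0 t = f t \<and> (\<forall>k. (F k has_real_derivative F (Suc k) t / t) (at t)))"
  unfolding euler_tower_def has_real_derivative_iff_has_vector_derivative real_scaleR_def
    divide_inverse_commute ..

lemma euler_tower_mult:
  fixes f :: "real \<Rightarrow> 'a::real_normed_algebra"
  assumes "euler_tower f F"
  shows "euler_tower (\<lambda>t. c * f t) (\<lambda>k t. c * F k t)"
  using assms unfolding euler_tower_def
  by (auto intro!: derivative_eq_intros simp flip: mult_scaleR_right)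

lemma euler_tower_of_real:
  assumes "euler_tower f F"
  shows "euler_tower (\<lambda>t. of_real (f t) :: 'a::real_normed_div_algebra) (\<lambda>k t. of_real (F k t))"
  using assms unfolding euler_tower_def
  by (auto intro!: has_vector_derivative_of_real
      simp: has_real_derivative_iff_has_vector_derivative scaleR_conv_of_real simp flip: of_real_mult of_real_inverse)

text \<open>The Euler operator is invariant under dilations, and the substitution of t^\<rho>
  multiplies it by \<rho>. With \<rho> = 1/m this accounts for the powers of m by which the two
  concomitants differ.\<close>

lemma euler_tower_power_substitution:
  fixes f :: "real \<Rightarrow> real"
  assumes "euler_tower f F" "\<kappa> > 0"
  shows "euler_tower (\<lambda>t. f (\<kappa> * t powr \<rho>)) (\<lambda>k t. \<rho> ^ k * F k (\<kappa> * t powr \<rho>))"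
  unfolding euler_tower_real
proof (intro allI impI conjI)
  fix t :: real assume t: "t > 0"
  then show "\<rho> ^ 0 * F 0 (\<kappa> * t powr \<rho>) = f (\<kappa> * t powr \<rho>)"
    using assms by (simp add: euler_tower_real)
  fix k
  have "(F k has_real_derivative F (Suc k) (\<kappa> * t powr \<rho>) / (\<kappa> * t powr \<rho>)) (at (\<kappa> * t powr \<rho>))"
    using assms t by (simp add: euler_tower_real)
  moreover have "((\<lambda>t. \<kappa> * t powr \<rho>) has_real_derivative \<kappa> * (\<rho> * t powr (\<rho> - 1))) (at t)"
    using t by (auto intro!: derivative_eq_intros)
  ultimately have "((\<lambda>t. F k (\<kappa> * t powr \<rho>)) has_real_derivative
      F (Suc k) (\<kappa> * t powr \<rho>) / (\<kappa> * t powr \<rho>) * (\<kappa> * (\<rho> * t powr (\<rho> - 1)))) (at t)"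
    by (rule DERIV_chain2)
  then have "((\<lambda>t. \<rho> ^ k * F k (\<kappa> * t powr \<rho>)) has_real_derivative
      \<rho> ^ k * (F (Suc k) (\<kappa> * t powr \<rho>) / (\<kappa> * t powr \<rho>) * (\<kappa> * (\<rho> * t powr (\<rho> - 1))))) (at t)"
    by (rule DERIV_cmult)
  also have "\<rho> ^ k * (F (Suc k) (\<kappa> * t powr \<rho>) / (\<kappa> * t powr \<rho>) * (\<kappa> * (\<rho> * t powr (\<rho> - 1)))) =
      \<rho> ^ Suc k * F (Suc k) (\<kappa> * t powr \<rho>) / t"
    using t assms(2) by (simp add: powr_diff field_simps)
  finally show "((\<lambda>t. \<rho> ^ k * F k (\<kappa> * t powr \<rho>)) has_real_derivative
      \<rho> ^ Suc k * F (Suc k) (\<kappa> * t powr \<rho>) / t) (at t)" .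
qed

section \<open>Power series with exponents a + p j and their limits at 0\<close>

definition entire_coeffs :: "(nat \<Rightarrow> real) \<Rightarrow> bool" where
  "entire_coeffs c \<longleftrightarrow> (\<forall>z. summable (\<lambda>j. c j * z ^ j))"

text \<open>The Euler operator is diagonal on these series: it multiplies the term of exponent a + p
  j by that exponent. Both factors of the kernel have this form.\<close>

definition powr_series :: "real \<Rightarrow> real \<Rightarrow> (nat \<Rightarrow> real) \<Rightarrow> real \<Rightarrow> real" where
  "powr_series a p c t = t powr a * (\<Sum>j. c j * (t powr p) ^ j)"

lemma sums_powr_series:
  assumes "entire_coeffs c" "t > 0"
  shows "(\<lambda>j. c j * t powr (a + p * real j)) sums powr_series a p c t"
proof -
  have "(\<lambda>j. t powr a * (c j * (t powr p) ^ j)) sums powr_series a p c t"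
    unfolding powr_series_def using assms(1)
    by (intro sums_mult summable_sums) (simp add: entire_coeffs_def)
  moreover have "t powr a * (c j * (t powr p) ^ j) = c j * t powr (a + p * real j)" for j
    using assms(2) by (simp add: powr_add powr_powr flip: powr_realpow)
  ultimately show ?thesis by simp
qed

lemma entire_coeffs_mult_of_nat:
  assumes "entire_coeffs c"
  shows "entire_coeffs (\<lambda>j. real j * c j)"
  unfolding entire_coeffs_def
proof
  fix z
  have "summable (\<lambda>n. diffs c n * z ^ n)"
    using assms by (intro termdiff_converges_all) (simp add: entire_coeffs_def)
  then have "summable (\<lambda>n. real n * c n * z ^ (n - Suc 0))"
    using diffs_equiv sums_summable by fastforce
  then have "summable (\<lambda>n. z * (real n * c n * z ^ (n - Suc 0)))"
    by (rule summable_mult)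
  also have "(\<lambda>n. z * (real n * c n * z ^ (n - Suc 0))) = (\<lambda>n. real n * c n * z ^ n)"
  proof
    show "z * (real n * c n * z ^ (n - Suc 0)) = real n * c n * z ^ n" for n
      by (cases n) auto
  qed
  finally show "summable (\<lambda>j. real j * c j * z ^ j)" .
qed

lemma entire_coeffs_add:
  "entire_coeffs c \<Longrightarrow> entire_coeffs d \<Longrightarrow> entire_coeffs (\<lambda>j. c j + d j)"
  by (auto simp: entire_coeffs_def ring_distribs intro!: summable_add)

lemma entire_coeffs_cmult: "entire_coeffs c \<Longrightarrow> entire_coeffs (\<lambda>j. x * c j)"
  by (auto simp: entire_coeffs_def mult.assoc intro!: summable_mult)

lemma entire_coeffs_mult_linear:
  assumes "entire_coeffs c"
  shows "entire_coeffs (\<lambda>j. c j * (a + p * real j))"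
  using entire_coeffs_add[OF entire_coeffs_cmult[OF assms, of a]
      entire_coeffs_cmult[OF entire_coeffs_mult_of_nat[OF assms], of p]]
  by (simp add: algebra_simps)

lemma entire_coeffs_mult_linear_power:
  assumes "entire_coeffs c"
  shows "entire_coeffs (\<lambda>j. c j * (a + p * real j) ^ k)"
proof (induction k)
  case (Suc k)
  from entire_coeffs_mult_linear[OF this, of a p] show ?case by (simp add: mult_ac)
qed (use assms in simp)

lemma has_derivative_powr_series:
  assumes "entire_coeffs c" "t > 0"
  shows "(powr_series a p c has_real_derivative
           powr_series a p (\<lambda>j. c j * (a + p * real j)) t / t) (at t)"
proof -
  let ?s = "t powr p"
  have E: "summable (\<lambda>j. c j * z ^ j)" "summable (\<lambda>j. real j * c j * z ^ j)"
    "summable (\<lambda>j. diffs c j * z ^ j)" for z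
    using assms(1) entire_coeffs_mult_of_nat[OF assms(1)] termdiff_converges_all[of c]
    by (auto simp: entire_coeffs_def)
  \<comment> \<open>An ordinary power series is differentiated termwise at the point
    \<open>t powr p\<close> and composed with the power function.\<close>
  have "((\<lambda>x. \<Sum>j. c j * x ^ j) has_real_derivative (\<Sum>j. diffs c j * ?s ^ j)) (at ?s)"
    using E by (intro termdiffs_strong_converges_everywhere)
  moreover have "((\<lambda>x. x powr p) has_real_derivative p * t powr (p - 1)) (at t)"
    using assms(2) by (auto intro!: derivative_eq_intros)
  ultimately have 1: "((\<lambda>x. \<Sum>j. c j * (x powr p) ^ j) has_real_derivative
      (\<Sum>j. diffs c j * ?s ^ j) * (p * t powr (p - 1))) (at t)"
    by (rule DERIV_chain2)
  have "((\<lambda>x. x powr a) has_real_derivative a * t powr (a - 1)) (at t)"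
    using assms(2) by (auto intro!: derivative_eq_intros)
  from DERIV_mult[OF this 1]
  have 2: "(powr_series a p c has_real_derivative
     a * t powr (a - 1) * (\<Sum>j. c j * ?s ^ j) +
      (\<Sum>j. diffs c j * ?s ^ j) * (p * t powr (p - 1)) * t powr a) (at t)"
    unfolding powr_series_def .
  have "(\<lambda>j. real j * c j * ?s ^ (j - Suc 0)) sums (\<Sum>j. diffs c j * ?s ^ j)"
    using E by (intro diffs_equiv)
  then have "(\<lambda>j. ?s * (real j * c j * ?s ^ (j - Suc 0))) sums (?s * (\<Sum>j. diffs c j * ?s ^ j))"
    by (rule sums_mult)
  moreover have "?s * (real j * c j * ?s ^ (j - Suc 0)) = real j * c j * ?s ^ j" for j
    by (cases j) auto
  ultimately have 3: "(\<Sum>j. real j * c j * ?s ^ j) = ?s * (\<Sum>j. diffs c j * ?s ^ j)"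
    by (simp add: sums_iff)
  have "(\<Sum>j. c j * (a + p * real j) * ?s ^ j) =
          (\<Sum>j. a * (c j * ?s ^ j) + p * (real j * c j * ?s ^ j))"
    by (simp add: algebra_simps)
  also have "\<dots> = a * (\<Sum>j. c j * ?s ^ j) + p * (\<Sum>j. real j * c j * ?s ^ j)"
    using E by (simp add: suminf_add[symmetric] suminf_mult summable_mult)
  finally have "powr_series a p (\<lambda>j. c j * (a + p * real j)) t / t =
     a * t powr (a - 1) * (\<Sum>j. c j * ?s ^ j) +
      (\<Sum>j. diffs c j * ?s ^ j) * (p * t powr (p - 1)) * t powr a"
    unfolding powr_series_def 3 using assms(2)
    by (simp add: powr_diff field_simps)
  with 2 show ?thesis by simp
qed

lemma euler_tower_powr_series:
  assumes "entire_coeffs c"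
  shows "euler_tower (powr_series a p c) (\<lambda>k. powr_series a p (\<lambda>j. c j * (a + p * real j) ^ k))"
  unfolding euler_tower_real
  using has_derivative_powr_series[OF entire_coeffs_mult_linear_power[OF assms]]
  by (simp add: mult_ac)

lemma entire_coeffs_sum:
  "(\<And>k. k \<in> A \<Longrightarrow> entire_coeffs (c k)) \<Longrightarrow> entire_coeffs (\<lambda>j. \<Sum>k\<in>A. c k j)"
  by (auto simp: entire_coeffs_def sum_distrib_right intro!: summable_sum)

text \<open>A polynomial in the Euler operator acts on the coefficients by its values at the
  exponents. The offset \<open>e\<close> will be 1 in the differential equations, which contain one
  Euler operator more than Q, and 0 in the limit at 0, where Q acts alone.\<close>

lemma powr_series_lincomb:
  fixes a p :: real and d :: "nat \<Rightarrow> real" and M e :: nat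
  assumes "entire_coeffs c" "t > 0"
  defines "q \<equiv> (\<lambda>j. \<Sum>k\<le>M. d k * (a + p * real j) ^ (k + e))"
  shows "(\<Sum>k\<le>M. d k * powr_series a p (\<lambda>j. c j * (a + p * real j) ^ (k + e)) t) =
           powr_series a p (\<lambda>j. c j * q j) t"
    and "entire_coeffs (\<lambda>j. c j * q j)"
proof -
  have q: "c j * q j = (\<Sum>k\<le>M. d k * (c j * (a + p * real j) ^ (k + e)))" for j
    by (simp add: q_def sum_distrib_left mult_ac)
  show E: "entire_coeffs (\<lambda>j. c j * q j)"
    unfolding q by (intro entire_coeffs_sum entire_coeffs_cmult entire_coeffs_mult_linear_power assms)
  have "(\<lambda>j. \<Sum>k\<le>M. d k * (c j * (a + p * real j) ^ (k + e) * t powr (a + p * real j))) sums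
           (\<Sum>k\<le>M. d k * powr_series a p (\<lambda>j. c j * (a + p * real j) ^ (k + e)) t)"
    by (intro sums_sum sums_mult sums_powr_series entire_coeffs_mult_linear_power assms)
  also have "(\<lambda>j. \<Sum>k\<le>M. d k * (c j * (a + p * real j) ^ (k + e) * t powr (a + p * real j))) =
               (\<lambda>j. c j * q j * t powr (a + p * real j))"
    by (simp add: q sum_distrib_right mult.assoc)
  finally show "(\<Sum>k\<le>M. d k * powr_series a p (\<lambda>j. c j * (a + p * real j) ^ (k + e)) t) =
           powr_series a p (\<lambda>j. c j * q j) t"
    using sums_powr_series[OF E assms(2)] sums_unique2 by blast
qed

lemma tendsto_powr_series_0:
  assumes "entire_coeffs c" "p > 0"
  shows "((\<lambda>t. powr_series a p c t / t powr a) \<longlongrightarrow> c 0) (at_right 0)"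
proof -
  have "isCont (\<lambda>x. \<Sum>j. c j * x ^ j) 0"
    using assms(1) by (intro isCont_powser_converges_everywhere) (simp add: entire_coeffs_def)
  then have "((\<lambda>x. \<Sum>j. c j * x ^ j) \<longlongrightarrow> c 0) (at 0)"
    by (simp add: isCont_def)
  moreover have "filterlim (\<lambda>t::real. t powr p) (at 0) (at_right 0)"
  proof (rule filterlim_atI)
    show "((\<lambda>t. t powr p) \<longlongrightarrow> 0) (at_right 0)"
      using assms(2) by real_asymp
    show "\<forall>\<^sub>F t in at_right (0::real). t powr p \<noteq> 0"
      by (auto simp: eventually_at_right_field intro: exI[of _ 1])
  qed
  ultimately have "((\<lambda>t. \<Sum>j. c j * (t powr p) ^ j) \<longlongrightarrow> c 0) (at_right 0)"
    by (rule filterlim_compose)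
  moreover have "\<forall>\<^sub>F t in at_right 0. (\<Sum>j. c j * (t powr p) ^ j) = powr_series a p c t / t powr a"
    by (auto simp: eventually_at_right_field powr_series_def intro: exI[of _ 1])
  ultimately show ?thesis by (rule Lim_transform_eventually)
qed

lemma entire_coeffs_shift:
  assumes "entire_coeffs c"
  shows "entire_coeffs (\<lambda>j. c (j + r))"
  unfolding entire_coeffs_def
proof
  fix z :: real
  show "summable (\<lambda>j. c (j + r) * z ^ j)"
  proof (cases "z = 0")
    case True
    then show ?thesis by (simp only: summable_zero_power')
  next
    case False
    have "summable (\<lambda>j. c (j + r) * z ^ (j + r) / z ^ r)"
      using assms by (intro summable_divide summable_ignore_initial_segment) (simp add: entire_coeffs_def)
    with False show ?thesis by (simp add: power_add)
  qed
qed

lemma powr_series_split_initial: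
  assumes "entire_coeffs c" "t > 0"
  shows "powr_series a p c t =
           (\<Sum>j<r. c j * t powr (a + p * real j)) + powr_series (a + p * real r) p (\<lambda>j. c (j + r)) t"
proof -
  have "(\<lambda>j. c (j + r) * t powr (a + p * real (j + r))) sums
          (powr_series a p c t - (\<Sum>j<r. c j * t powr (a + p * real j)))"
    using sums_powr_series[OF assms, of a p] by (subst sums_iff_shift) auto
  also have "(\<lambda>j. c (j + r) * t powr (a + p * real (j + r))) =
               (\<lambda>j. c (j + r) * t powr (a + p * real r + p * real j))"
    by (simp add: algebra_simps)
  finally show ?thesis
    using sums_powr_series[OF entire_coeffs_shift[OF assms(1)] assms(2), of r "a + p * real r" p]
    by (smt (verit) sums_unique2)
qed

lemma powr_series_shift:
  assumes "entire_coeffs c" "t > 0" "\<And>j. j < r \<Longrightarrow> c j = 0"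
  shows "powr_series a p c t = powr_series (a + p * real r) p (\<lambda>j. c (j + r)) t"
  by (subst powr_series_split_initial[OF assms(1,2), of _ _ r]) (simp add: assms(3))

lemma powr_series_cmult:
  "entire_coeffs c \<Longrightarrow> powr_series a p (\<lambda>j. x * c j) t = x * powr_series a p c t"
  by (simp add: powr_series_def entire_coeffs_def suminf_mult mult.assoc)

lemma tendsto_powr_series_scaled:
  assumes "entire_coeffs c" "p > 0" "x > 0" "a > 0"
  shows "((\<lambda>u. powr_series a p c (u * x)) \<longlongrightarrow> 0) (at_right 0)"
proof -
  have 1: "filterlim (\<lambda>u. u * x) (at_right 0) (at_right 0)"
    using assms(3) by real_asymp
  have "((\<lambda>u. powr_series a p c (u * x) / (u * x) powr a * (u * x) powr a) \<longlongrightarrow> c 0 * 0) (at_right 0)"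
    using assms by (intro tendsto_mult filterlim_compose[OF tendsto_powr_series_0 1]) (auto, real_asymp)
  then show ?thesis
    by (rule Lim_transform_eventually[THEN tendsto_eq_rhs])
       (use assms(3) in \<open>auto simp: eventually_at_right_field intro: exI[of _ 1]\<close>)
qed

text \<open>After the pure powers are split off, both remaining factors have finite limits, so only
  the sum of the two leading exponents matters. One of them may be negative, as happens for f when
  \<alpha> < m - 1.\<close>

lemma tendsto_powr_series_mult_scaled:
  assumes "entire_coeffs c" "p > 0" "x > 0" "entire_coeffs d" "q > 0" "y > 0" "a + b > 0"
  shows "((\<lambda>u. powr_series a p c (u * x) * powr_series b q d (u * y)) \<longlongrightarrow> 0) (at_right 0)"
proof -
  have 1: "filterlim (\<lambda>u. u * z) (at_right 0) (at_right 0)" if "z > 0" for z :: real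
    using that by real_asymp
  have "((\<lambda>u::real. u powr (a + b)) \<longlongrightarrow> 0) (at_right 0)"
    using assms(7) by real_asymp
  then have "((\<lambda>u. powr_series a p c (u * x) / (u * x) powr a * (powr_series b q d (u * y) / (u * y) powr b) *
          (u powr (a + b) * (x powr a * y powr b))) \<longlongrightarrow> c 0 * d 0 * (0 * (x powr a * y powr b))) (at_right 0)"
    using assms by (intro tendsto_mult filterlim_compose[OF tendsto_powr_series_0 1] tendsto_const) auto
  then show ?thesis
    by (rule Lim_transform_eventually[THEN tendsto_eq_rhs])
       (use assms in \<open>auto simp: eventually_at_right_field powr_mult powr_add field_simps intro!: exI[of _ 1]\<close>)
qed

text \<open>The values of \<open>rGamma\<close> on the half-line to the right of \<open>a\<close>, a
  half strip of height 0, are bounded, so the exponential series dominates.\<close>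

lemma entire_coeffs_wright:
  assumes "b \<ge> 0"
  shows "entire_coeffs (\<lambda>j. (- 1) ^ j / fact j * rGamma (a + b * real j))"
  unfolding entire_coeffs_def
proof
  fix z :: real
  obtain B where B: "B > 0" "\<And>z. Re z \<ge> a \<Longrightarrow> \<bar>Im z\<bar> \<le> 0 \<Longrightarrow> norm (rGamma z) \<le> B"
    using rGamma_bounded_half_strip[of a 0] by metis
  have bound: "\<bar>rGamma (a + b * real j)\<bar> \<le> B" for j
    using B(2)[of "of_real (a + b * real j)"] assms
    unfolding rGamma_complex_of_real norm_of_real by simp
  have "norm ((- 1) ^ j / fact j * rGamma (a + b * real j) * z ^ j) \<le> B * (\<bar>z\<bar> ^ j /\<^sub>R fact j)" for j
  proof -
    have "norm ((- 1) ^ j / fact j * rGamma (a + b * real j) * z ^ j) =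
        \<bar>rGamma (a + b * real j)\<bar> * (\<bar>z\<bar> ^ j /\<^sub>R fact j)"
      by (simp add: abs_mult power_abs field_simps)
    also have "\<dots> \<le> B * (\<bar>z\<bar> ^ j /\<^sub>R fact j)"
      by (intro mult_right_mono bound) auto
    finally show ?thesis .
  qed
  moreover have "summable (\<lambda>j. B * (\<bar>z\<bar> ^ j /\<^sub>R fact j))"
    by (intro summable_mult summable_exp_generic)
  ultimately show "summable (\<lambda>j. (- 1) ^ j / fact j * rGamma (a + b * real j) * z ^ j)"
    by (rule summable_comparison_test'[rotated])
qed

lemma powr_mult_wright_J:
  fixes a e t b p :: real
  shows "t powr e * wright_J a b (t powr p) = powr_series e p (\<lambda>j. (- 1) ^ j / fact j * rGamma (a + b * real j)) t"
proof -
  have "(- (t powr p)) ^ j / fact j * rGamma (a + of_real (b * real j)) =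
          (- 1) ^ j / fact j * rGamma (a + b * real j) * (t powr p) ^ j" for j
    using power_minus[of "t powr p" j] by simp
  then show ?thesis by (simp only: wright_J_def powr_series_def)
qed

section \<open>The bilinear concomitant\<close>

text \<open>The coefficient depends only on the total order k = i + j. Grouping by k isolates
  alternating sums to which the telescoping identity applies.\<close>

lemma sum_triangle_concomitant:
  fixes c :: "nat \<Rightarrow> 'a::comm_ring_1"
  shows "(\<Sum>j=0..M. (- 1) ^ j * A j * (\<Sum>i=0..M-j. c (i + j) * B i)) =
           (\<Sum>k\<le>M. c k * (\<Sum>j\<le>k. (- 1) ^ j * A j * B (k - j)))"
proof -
  have "(\<Sum>j=0..M. (- 1) ^ j * A j * (\<Sum>i=0..M-j. c (i + j) * B i)) =
          (\<Sum>(j, i)\<in>Sigma {0..M} (\<lambda>j. {0..M-j}). (- 1) ^ j * A j * (c (i + j) * B i))"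
    by (simp add: sum_distrib_left sum.Sigma)
  also have "Sigma {0..M} (\<lambda>j. {0..M-j}) = {(j, i). j + i \<le> M}"
    by auto
  also have "(\<Sum>(j, i)\<in>{(j, i). j + i \<le> M}. (- 1) ^ j * A j * (c (i + j) * B i)) =
      (\<Sum>k\<le>M. \<Sum>j\<le>k. (- 1) ^ j * A j * (c (k - j + j) * B (k - j)))"
    by (rule sum.triangle_reindex_eq)
  also have "\<dots> = (\<Sum>k\<le>M. c k * (\<Sum>j\<le>k. (- 1) ^ j * A j * B (k - j)))"
    by (simp add: sum_distrib_left mult_ac)
  finally show ?thesis .
qed

text \<open>Lagrange's identity: for A_j = D^j f and B_j = D^j g, the left side is D applied to the
  alternating sum of order k. Neighbouring terms cancel, and in the two that remain all derivatives
  fall on one factor.\<close>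

lemma sum_alternating_telescope:
  fixes A B :: "nat \<Rightarrow> 'a::comm_ring_1"
  shows "(\<Sum>j\<le>k. (- 1) ^ j * (A (Suc j) * B (k - j) + A j * B (Suc (k - j)))) =
           A 0 * B (Suc k) + (- 1) ^ k * A (Suc k) * B 0"
proof -
  let ?g = "\<lambda>j. (- 1) ^ j * A j * B (Suc k - j)"
  have "(\<Sum>j\<le>k. (- 1) ^ j * (A (Suc j) * B (k - j) + A j * B (Suc (k - j)))) =
          (\<Sum>j\<le>k. ?g j - ?g (Suc j))"
    by (intro sum.cong) (auto simp: algebra_simps Suc_diff_le)
  also have "\<dots> = ?g 0 - ?g (Suc k)" by (rule sum_telescope)
  finally show ?thesis by simp
qed

lemma concomitant_euler_tower:
  assumes "euler_tower f F" "euler_tower g G" "x > 0" "y > 0"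
  shows "concomitant m n \<alpha> f g x y = (- 1) ^ (n + 1) *
    (\<Sum>k\<le>m+n-1. of_real (b_coeff m n \<alpha> k / real m ^ k) * (\<Sum>j\<le>k. (- 1) ^ j * F j x * G (k - j) y))"
  unfolding concomitant_def euler_tower_euler_op[OF assms(1,3)] euler_tower_euler_op[OF assms(2,4)]
  by (rule arg_cong[OF sum_triangle_concomitant[where A = "\<lambda>j. F j x" and B = "\<lambda>i. G i y" and
        c = "\<lambda>k. of_real (b_coeff m n \<alpha> k / real m ^ k)"]])

lemma concomitant_tilde_euler_tower:
  assumes "euler_tower f F" "euler_tower g G" "x > 0" "y > 0"
  shows "concomitant_tilde m n \<alpha> f g x y = (- 1) ^ (n + 1) *
    (\<Sum>k\<le>m+n-1. of_real (b_coeff m n \<alpha> k) * (\<Sum>j\<le>k. (- 1) ^ j * F j x * G (k - j) y))"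
  unfolding concomitant_tilde_def euler_tower_euler_op[OF assms(1,3)] euler_tower_euler_op[OF assms(2,4)]
  by (rule arg_cong[OF sum_triangle_concomitant[where A = "\<lambda>j. F j x" and B = "\<lambda>i. G i y" and
        c = "\<lambda>k. of_real (b_coeff m n \<alpha> k)"]])

section \<open>The polynomial with the roots nu_i as a product of Pochhammer symbols\<close>

lemma prod_divide_of_nat_eq_pochhammer:
  fixes X :: real
  assumes "m > 0"
  shows "(\<Prod>l<m. X + real l / real m) = pochhammer (real m * X) m / real m ^ m"
proof -
  have "(\<Prod>l<m. X + real l / real m) = (\<Prod>l<m. (real m * X + real l) / real m)"
    using assms by (intro prod.cong) (auto simp: field_simps)
  then show ?thesis by (simp add: prod_dividef pochhammer_prod atLeast0LessThan)
qed

text \<open>The roots nu_n, ..., nu_(m+n-1) descend in steps of 1/m, so their linear factors combine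
  to a Pochhammer symbol; the other roots are the fractions i/n with 0 < i < n.\<close>

lemma prod_nu_eq_pochhammer:
  assumes "m \<ge> 1" "n \<ge> 1"
  shows "(\<Sum>k\<le>m+n-1. b_coeff m n \<alpha> k * X ^ k) =
           (\<Prod>i\<in>{1..<n}. X - real i / real n) * (pochhammer (real m * X - real m + \<alpha> + 1) m / real m ^ m)"
proof -
  have "(\<Sum>k\<le>m+n-1. b_coeff m n \<alpha> k * X ^ k) = (\<Prod>l\<in>{1..<n} \<union> {n..<m+n}. X - nu m n \<alpha> l)"
    using assms unfolding atMost_atLeast0 prod_nu_eq_sum_b_coeff[symmetric]
    by (intro prod.cong) auto
  also have "\<dots> = (\<Prod>l\<in>{1..<n}. X - nu m n \<alpha> l) * (\<Prod>l\<in>{n..<m+n}. X - nu m n \<alpha> l)"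
    by (intro prod.union_disjoint) auto
  also have "(\<Prod>l\<in>{1..<n}. X - nu m n \<alpha> l) = (\<Prod>i\<in>{1..<n}. X - real i / real n)"
    by (intro prod.cong) (auto simp: nu_def)
  also have "(\<Prod>l\<in>{n..<m+n}. X - nu m n \<alpha> l) = (\<Prod>l\<in>{0..<m}. X - nu m n \<alpha> (l + n))"
    using prod.shift_bounds_nat_ivl[of "\<lambda>l. X - nu m n \<alpha> l" 0 n m] by simp
  also have "\<dots> = (\<Prod>l<m. X - 1 + (\<alpha> + 1) / real m + real l / real m)"
    unfolding atLeast0LessThan using assms
    by (intro prod.cong) (auto simp: nu_def field_simps)
  also have "\<dots> = pochhammer (real m * X - real m + \<alpha> + 1) m / real m ^ m"
  proof -
    have "real m * (X - 1 + (\<alpha> + 1) / real m) = real m * X - real m + \<alpha> + 1"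
      using assms by (simp add: field_simps)
    then show ?thesis
      using assms prod_divide_of_nat_eq_pochhammer[of m "X - 1 + (\<alpha> + 1) / real m"] by simp
  qed
  finally show ?thesis .
qed

text \<open>The factor X supplies the root nu_0 = 0, which completes the fractions i/n to a second
  Pochhammer symbol. It corresponds to the extra Euler operator in the differential
  equations.\<close>

lemma mult_prod_nu_eq_pochhammer:
  assumes "m \<ge> 1" "n \<ge> 1"
  shows "X * (\<Sum>k\<le>m+n-1. b_coeff m n \<alpha> k * X ^ k) =
           (- 1) ^ n * pochhammer (- (real n * X)) n / real n ^ n *
           (pochhammer (real m * X - real m + \<alpha> + 1) m / real m ^ m)"
proof -
  have "X * (\<Prod>i\<in>{1..<n}. X - real i / real n) = (\<Prod>i<n. X - real i / real n)"
    using assms(2) prod.atLeast_Suc_lessThan[of 0 n "\<lambda>i. X - real i / real n"] by (simp add: atLeast0LessThan)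
  also have "\<dots> = (\<Prod>i<n. (- 1) * (- X + real i / real n))"
    by (intro prod.cong) auto
  also have "\<dots> = (- 1) ^ n * (pochhammer (- (real n * X)) n / real n ^ n)"
    unfolding prod.distrib prod_divide_of_nat_eq_pochhammer[OF assms(2)[unfolded One_nat_def Suc_le_eq]]
    by simp
  finally have "X * (\<Prod>i\<in>{1..<n}. X - real i / real n) =
      (- 1) ^ n * (pochhammer (- (real n * X)) n / real n ^ n)" .
  then show ?thesis
    unfolding prod_nu_eq_pochhammer[OF assms] mult.assoc[symmetric] by simp
qed

text \<open>At these negative integers the Pochhammer symbol is the quotient of factorials that an
  index shift produces in the coefficients of a Wright series.\<close>

lemma pochhammer_minus_of_nat_add:
  "pochhammer (- real (j + n)) n = (- 1) ^ n * fact (j + n) / fact j"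
proof -
  have "pochhammer (- real (j + n)) n = (- 1) ^ n * pochhammer (real j + 1) n"
    by (subst pochhammer_minus) (simp add: of_nat_diff algebra_simps)
  also have "pochhammer (real j + 1) n = fact (j + n) / fact j"
    using pochhammer_product'[of "1::real" j n]
    by (simp add: field_simps flip: pochhammer_fact)
  finally show ?thesis by simp
qed

section \<open>Coefficient recurrences and differential equations of the two factors\<close>

locale wright_parameters =
  fixes m n :: nat and \<alpha> :: real
  assumes m: "m \<ge> 1" and n: "n \<ge> 1"
    and \<alpha>: "\<alpha> > real m - 1 - real m / real n"
begin

definition f_coeff :: "nat \<Rightarrow> real" where
  "f_coeff j = (- 1) ^ j / fact j * rGamma ((\<alpha> + 1) * real n / real m + real n / real m * real j)"

definition g_coeff :: "nat \<Rightarrow> real" where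
  "g_coeff j = (- 1) ^ j / fact j * rGamma (\<alpha> + 1 + real m / real n * real j)"

text \<open>The redundant \<open>1 *\<close> here and \<open>0 +\<close> below keep the shape
  \<open>a + p * real j\<close> of the general results on \<open>powr_series\<close>.\<close>

abbreviation "f_exponent j \<equiv> \<alpha> + 1 - real m + 1 * real j"
abbreviation "g_exponent j \<equiv> 0 + real m / real n * real j"

definition F :: "nat \<Rightarrow> real \<Rightarrow> real" where
  "F k = powr_series (\<alpha> + 1 - real m) 1 (\<lambda>j. f_coeff j * f_exponent j ^ k)"

definition G :: "nat \<Rightarrow> real \<Rightarrow> real" where
  "G k = powr_series 0 (real m / real n) (\<lambda>j. g_coeff j * g_exponent j ^ k)"

text \<open>The powers of m and n are the denominators of the two Pochhammer symbols, and the factor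
  m arises because the polynomial is taken at plus or minus the exponent over m. The sign comes from
  the alternating coefficients in the equation of g, and from reversing n linear factors in that of
  f.\<close>

definition ode_const :: real where
  "ode_const = (- 1) ^ n * real m / (real m ^ m * real n ^ n)"

abbreviation "b k \<equiv> b_coeff m n \<alpha> k / real m ^ k"

lemma entire_f_coeff: "entire_coeffs f_coeff"
  unfolding f_coeff_def by (rule entire_coeffs_wright) simp

lemma entire_g_coeff: "entire_coeffs g_coeff"
  unfolding g_coeff_def by (rule entire_coeffs_wright) simp

lemma euler_tower_F:
  "euler_tower (\<lambda>t. t powr (\<alpha> + 1 - real m) * wright_J ((\<alpha> + 1) * real n / real m) (real n / real m) t) F"
proof (rule euler_tower_cong)
  show "euler_tower (powr_series (\<alpha> + 1 - real m) 1 f_coeff) F"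
    unfolding F_def by (rule euler_tower_powr_series[OF entire_f_coeff])
  show "powr_series (\<alpha> + 1 - real m) 1 f_coeff t =
     t powr (\<alpha> + 1 - real m) * wright_J ((\<alpha> + 1) * real n / real m) (real n / real m) t" if "t > 0" for t
    using that powr_mult_wright_J[of t "\<alpha> + 1 - real m" "(\<alpha> + 1) * real n / real m" "real n / real m" 1]
    by (simp add: f_coeff_def[abs_def])
qed

lemma euler_tower_G:
  "euler_tower (\<lambda>t. wright_J (\<alpha> + 1) (real m / real n) (t powr (real m / real n))) G"
proof (rule euler_tower_cong)
  show "euler_tower (powr_series 0 (real m / real n) g_coeff) G"
    unfolding G_def by (rule euler_tower_powr_series[OF entire_g_coeff])
  show "powr_series 0 (real m / real n) g_coeff t =
      wright_J (\<alpha> + 1) (real m / real n) (t powr (real m / real n))" if "t > 0" for t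
    using that powr_mult_wright_J[of t 0 "\<alpha> + 1" "real m / real n" "real m / real n"]
    by (simp add: g_coeff_def[abs_def])
qed

lemma F_0: "F 0 = powr_series (\<alpha> + 1 - real m) 1 f_coeff"
  by (simp add: F_def)

lemma G_0: "G 0 = powr_series 0 (real m / real n) g_coeff"
  by (simp add: G_def)

lemma sum_b_powers:
  "(\<Sum>k\<le>m+n-1. (- 1) ^ k * b k * s ^ k) = (\<Sum>k\<le>m+n-1. b_coeff m n \<alpha> k * (- s / real m) ^ k)"
  "(\<Sum>k\<le>m+n-1. b k * s ^ k) = (\<Sum>k\<le>m+n-1. b_coeff m n \<alpha> k * (s / real m) ^ k)"
  by (intro sum.cong refl; simp add: power_divide power_minus[of "s / real m"])+

text \<open>The Pochhammer symbol of length m starts at -j and so runs through 0. Q(-D) alone kills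
  these terms, and the limit at 0 relies on that; the constant term of g is killed through the extra
  factor D.\<close>

lemma f_coeff_initial:
  assumes "j < m"
  shows "f_coeff j * (\<Sum>k\<le>m+n-1. (- 1) ^ k * b k * f_exponent j ^ k) = 0"
proof -
  have "real m * (- f_exponent j / real m) - real m + \<alpha> + 1 = - real j"
    using m by (simp add: field_simps)
  then show ?thesis
    unfolding sum_b_powers prod_nu_eq_pochhammer[OF m n]
    using assms by (simp add: pochhammer_of_nat_eq_0_lemma)
qed

lemma f_coeff_recurrence:
  "f_coeff (j + m) * (\<Sum>k\<le>m+n-1. (- 1) ^ k * b k * f_exponent (j + m) ^ (k + 1)) =
     - ode_const * f_coeff j"
proof -
  define s where "s = f_exponent (j + m)"
  \<comment> \<open>At this point, the Pochhammer symbol of length \<open>n\<close> starts at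
    \<open>z\<close> and turns \<open>rGamma (z + of_nat n)\<close> into \<open>rGamma z\<close>,
    while the one of length \<open>m\<close> starts at \<open>- real (j + m)\<close> and exchanges
    the factorials.\<close>
  define X where "X = - s / real m"
  define z where "z = (\<alpha> + 1) * real n / real m + real n / real m * real j"
  have z: "- (real n * X) = z" "real m * X - real m + \<alpha> + 1 = - real (j + m)"
    using m n by (simp_all add: X_def s_def z_def field_simps)
  have s: "s = - real m * X" using m by (simp add: X_def)
  have "(\<Sum>k\<le>m+n-1. (- 1) ^ k * b k * s ^ (k + 1)) = s * (\<Sum>k\<le>m+n-1. (- 1) ^ k * b k * s ^ k)"
    by (simp add: sum_distrib_left mult_ac)
  also have "\<dots> = - real m * (X * (\<Sum>k\<le>m+n-1. b_coeff m n \<alpha> k * X ^ k))"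
    unfolding sum_b_powers X_def[symmetric] by (simp add: s)
  also have "\<dots> = - real m * ((- 1) ^ n * pochhammer z n / real n ^ n *
                     (((- 1) ^ m * fact (j + m) / fact j) / real m ^ m))"
    unfolding mult_prod_nu_eq_pochhammer[OF m n] z pochhammer_minus_of_nat_add ..
  finally have 1: "(\<Sum>k\<le>m+n-1. (- 1) ^ k * b k * s ^ (k + 1)) =
    - real m * ((- 1) ^ n * pochhammer z n / real n ^ n *
                     (((- 1) ^ m * fact (j + m) / fact j) / real m ^ m))" .
  have "(\<alpha> + 1) * real n / real m + real n / real m * real (j + m) = z + of_nat n"
    using m by (simp add: z_def field_simps)
  then have 2: "f_coeff (j + m) = (- 1) ^ (j + m) / fact (j + m) * rGamma (z + of_nat n)"
    by (simp only: f_coeff_def)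
  have 3: "f_coeff j = (- 1) ^ j / fact j * (pochhammer z n * rGamma (z + of_nat n))"
    by (simp add: f_coeff_def z_def flip: pochhammer_rGamma)
  have "(- 1) ^ m * (- 1) ^ m = (1::real)" by (simp flip: power_mult_distrib)
  then show ?thesis
    unfolding s_def[symmetric] 1 2 3 ode_const_def by (simp add: power_add field_simps)
qed

lemma g_coeff_recurrence_initial:
  assumes "j < n"
  shows "g_coeff j * (\<Sum>k\<le>m+n-1. b k * g_exponent j ^ (k + 1)) = 0"
proof -
  define X where "X = g_exponent j / real m"
  have z: "- (real n * X) = - real j" and s: "g_exponent j = real m * X"
    using m n by (simp_all add: X_def)
  have "(\<Sum>k\<le>m+n-1. b k * g_exponent j ^ (k + 1)) = g_exponent j * (\<Sum>k\<le>m+n-1. b k * g_exponent j ^ k)"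
    by (simp add: sum_distrib_left mult_ac)
  also have "\<dots> = real m * (X * (\<Sum>k\<le>m+n-1. b_coeff m n \<alpha> k * X ^ k))"
    unfolding sum_b_powers X_def[symmetric] unfolding s by simp
  also have "\<dots> = 0"
    unfolding mult_prod_nu_eq_pochhammer[OF m n] z
    using assms by (simp add: pochhammer_of_nat_eq_0_lemma)
  finally show ?thesis by simp
qed

lemma g_coeff_recurrence:
  "g_coeff (j + n) * (\<Sum>k\<le>m+n-1. b k * g_exponent (j + n) ^ (k + 1)) = ode_const * g_coeff j"
proof -
  define s where "s = g_exponent (j + n)"
  \<comment> \<open>Without the minus sign the roles are reversed: the symbol of length
    \<open>n\<close> now exchanges the factorials, and the one of length \<open>m\<close> shifts the
    argument of \<open>rGamma\<close>.\<close>
  define X where "X = s / real m"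
  define z where "z = \<alpha> + 1 + real m / real n * real j"
  have z: "- (real n * X) = - real (j + n)" "real m * X - real m + \<alpha> + 1 = z"
    using m n by (simp_all add: X_def s_def z_def field_simps)
  have s: "s = real m * X" using m by (simp add: X_def)
  have "(\<Sum>k\<le>m+n-1. b k * s ^ (k + 1)) = s * (\<Sum>k\<le>m+n-1. b k * s ^ k)"
    by (simp add: sum_distrib_left mult_ac)
  also have "\<dots> = real m * (X * (\<Sum>k\<le>m+n-1. b_coeff m n \<alpha> k * X ^ k))"
    unfolding sum_b_powers X_def[symmetric] by (simp add: s)
  also have "\<dots> = real m * ((- 1) ^ n * ((- 1) ^ n * fact (j + n) / fact j) / real n ^ n *
                     (pochhammer z m / real m ^ m))"
    unfolding mult_prod_nu_eq_pochhammer[OF m n] z pochhammer_minus_of_nat_add ..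
  finally have 1: "(\<Sum>k\<le>m+n-1. b k * s ^ (k + 1)) = real m * ((- 1) ^ n * ((- 1) ^ n * fact (j + n) / fact j) / real n ^ n *
                     (pochhammer z m / real m ^ m))" .
  have "\<alpha> + 1 + real m / real n * real (j + n) = z + of_nat m"
    using n by (simp add: z_def field_simps)
  then have 2: "g_coeff (j + n) = (- 1) ^ (j + n) / fact (j + n) * rGamma (z + of_nat m)"
    by (simp only: g_coeff_def)
  have 3: "g_coeff j = (- 1) ^ j / fact j * (pochhammer z m * rGamma (z + of_nat m))"
    by (simp add: g_coeff_def z_def flip: pochhammer_rGamma)
  have "(- 1) ^ n * (- 1) ^ n = (1::real)" by (simp flip: power_mult_distrib)
  then show ?thesis
    unfolding s_def[symmetric] 1 2 3 ode_const_def by (simp add: power_add field_simps)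
qed

lemma F_ode:
  assumes "t > 0"
  shows "(\<Sum>k\<le>m+n-1. b k * ((- 1) ^ k * F (Suc k) t)) = - ode_const * t ^ m * F 0 t"
proof -
  let ?q = "\<lambda>j. \<Sum>k\<le>m+n-1. (- 1) ^ k * b k * f_exponent j ^ (k + 1)"
  have "(\<Sum>k\<le>m+n-1. b k * ((- 1) ^ k * F (Suc k) t)) =
      (\<Sum>k\<le>m+n-1. (- 1) ^ k * b k * powr_series (\<alpha> + 1 - real m) 1 (\<lambda>j. f_coeff j * f_exponent j ^ (k + 1)) t)"
    by (simp add: F_def mult_ac)
  also have "\<dots> = powr_series (\<alpha> + 1 - real m) 1 (\<lambda>j. f_coeff j * ?q j) t"
    by (rule powr_series_lincomb[OF entire_f_coeff assms])
  also have "\<dots> = powr_series (\<alpha> + 1 - real m + 1 * real m) 1 (\<lambda>j. f_coeff (j + m) * ?q (j + m)) t"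
  proof (rule powr_series_shift[where c = "\<lambda>j. f_coeff j * ?q j", OF _ assms])
    show "entire_coeffs (\<lambda>j. f_coeff j * ?q j)"
      by (rule powr_series_lincomb(2)[OF entire_f_coeff assms])
    fix j assume "j < m"
    have "f_coeff j * ?q j = f_exponent j * (f_coeff j * (\<Sum>k\<le>m+n-1. (- 1) ^ k * b k * f_exponent j ^ k))"
      by (simp add: sum_distrib_left mult_ac)
    then show "f_coeff j * ?q j = 0"
      unfolding f_coeff_initial[OF \<open>j < m\<close>] by simp
  qed
  also have "\<dots> = - ode_const * (powr_series (\<alpha> + 1 - real m + 1 * real m) 1 f_coeff t)"
    unfolding f_coeff_recurrence by (rule powr_series_cmult[OF entire_f_coeff])
  also have "powr_series (\<alpha> + 1 - real m + 1 * real m) 1 f_coeff t = t ^ m * F 0 t"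
    unfolding F_0 powr_series_def powr_add using assms by (simp add: powr_realpow)
  finally show ?thesis by simp
qed

text \<open>A shift by n coefficients in steps of m/n raises the exponent by m, as m unit steps do
  for f. Hence the same factor t^m appears in both equations.\<close>

lemma G_ode:
  assumes "t > 0"
  shows "(\<Sum>k\<le>m+n-1. b k * G (Suc k) t) = ode_const * t ^ m * G 0 t"
proof -
  let ?q = "\<lambda>j. \<Sum>k\<le>m+n-1. b k * g_exponent j ^ (k + 1)"
  have "(\<Sum>k\<le>m+n-1. b k * G (Suc k) t) =
      (\<Sum>k\<le>m+n-1. b k * powr_series 0 (real m / real n) (\<lambda>j. g_coeff j * g_exponent j ^ (k + 1)) t)"
    by (simp add: G_def)
  also have "\<dots> = powr_series 0 (real m / real n) (\<lambda>j. g_coeff j * ?q j) t"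
    by (rule powr_series_lincomb[OF entire_g_coeff assms])
  also have "\<dots> = powr_series (0 + real m / real n * real n) (real m / real n) (\<lambda>j. g_coeff (j + n) * ?q (j + n)) t"
    by (rule powr_series_shift[where c = "\<lambda>j. g_coeff j * ?q j", OF _ assms])
      (rule powr_series_lincomb(2)[OF entire_g_coeff assms], rule g_coeff_recurrence_initial)
  also have "\<dots> = ode_const * (powr_series (0 + real m / real n * real n) (real m / real n) g_coeff t)"
    unfolding g_coeff_recurrence by (rule powr_series_cmult[OF entire_g_coeff])
  also have "powr_series (0 + real m / real n * real n) (real m / real n) g_coeff t = t ^ m * G 0 t"
    unfolding G_0 powr_series_def powr_add using assms n by (simp add: powr_realpow)
  finally show ?thesis by simp
qed

section \<open>The concomitant along rays and the kernel integral\<close>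

definition bilinear :: "real \<Rightarrow> real \<Rightarrow> real" where
  "bilinear x y = (\<Sum>k\<le>m+n-1. b k * (\<Sum>j\<le>k. (- 1) ^ j * F j x * G (k - j) y))"

text \<open>When both arguments are scaled by u, the derivation u d/du acts as the Euler operator on
  either factor. Lagrange's identity leaves two boundary sums, which the differential equations
  evaluate.\<close>

lemma has_derivative_bilinear:
  assumes "x > 0" "y > 0" "u > 0"
  shows "((\<lambda>u. bilinear (u * x) (u * y)) has_real_derivative
            ode_const * u ^ (m - 1) * (y ^ m - x ^ m) * (F 0 (u * x) * G 0 (u * y))) (at u)"
proof -
  have scaled: "((\<lambda>u. H (u * z)) has_real_derivative D / u) (at u)"
    if "(H has_real_derivative D / (u * z)) (at (u * z))" "z > 0" for H z D
  proof -
    have "((\<lambda>u. H (u * z)) has_real_derivative D / (u * z) * z) (at u)"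
      by (rule DERIV_chain2[where f = H and g = "\<lambda>u. u * z", OF that(1)])
        (auto intro!: derivative_eq_intros)
    with that(2) show ?thesis by simp
  qed
  have dF: "((\<lambda>u. F k (u * x)) has_real_derivative F (Suc k) (u * x) / u) (at u)" for k
    using euler_tower_F assms by (intro scaled) (auto simp: euler_tower_real)
  have dG: "((\<lambda>u. G k (u * y)) has_real_derivative G (Suc k) (u * y) / u) (at u)" for k
    using euler_tower_G assms by (intro scaled) (auto simp: euler_tower_real)
  have "((\<lambda>u. bilinear (u * x) (u * y)) has_real_derivative
     (\<Sum>k\<le>m+n-1. b k * (\<Sum>j\<le>k. (- 1) ^ j * (F (Suc j) (u * x) / u) * G (k - j) (u * y) +
         G (Suc (k - j)) (u * y) / u * ((- 1) ^ j * F j (u * x))))) (at u)"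
    unfolding bilinear_def by (intro DERIV_sum DERIV_cmult DERIV_mult dF dG)
  also have "(\<Sum>k\<le>m+n-1. b k * (\<Sum>j\<le>k. (- 1) ^ j * (F (Suc j) (u * x) / u) * G (k - j) (u * y) +
         G (Suc (k - j)) (u * y) / u * ((- 1) ^ j * F j (u * x)))) =
     (\<Sum>k\<le>m+n-1. b k * ((\<Sum>j\<le>k. (- 1) ^ j * (F (Suc j) (u * x) * G (k - j) (u * y) +
         F j (u * x) * G (Suc (k - j)) (u * y))) / u))"
    by (simp add: sum_divide_distrib add_divide_distrib ring_distribs mult_ac)
  also have "\<dots> = (F 0 (u * x) * (\<Sum>k\<le>m+n-1. b k * G (Suc k) (u * y)) +
      G 0 (u * y) * (\<Sum>k\<le>m+n-1. b k * ((- 1) ^ k * F (Suc k) (u * x)))) / u"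
    unfolding sum_alternating_telescope[where A = "\<lambda>j. F j (u * x)" and B = "\<lambda>j. G j (u * y)"]
    by (simp add: sum_divide_distrib add_divide_distrib ring_distribs sum_distrib_left sum.distrib mult_ac)
  also have "\<dots> = (F 0 (u * x) * (ode_const * (u * y) ^ m * G 0 (u * y)) +
      G 0 (u * y) * (- ode_const * (u * x) ^ m * F 0 (u * x))) / u"
    using F_ode[of "u * x"] G_ode[of "u * y"] assms by (simp only: mult_pos_pos)
  also have "\<dots> = u ^ m / u * (ode_const * (y ^ m - x ^ m) * (F 0 (u * x) * G 0 (u * y)))"
    by (simp add: power_mult_distrib diff_divide_distrib algebra_simps)
  also have "u ^ m / u = u ^ (m - 1)"
    using assms m by (simp add: power_diff)
  finally show ?thesis by (simp add: mult_ac)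
qed

lemma tendsto_bilinear:
  assumes "x > 0" "y > 0"
  shows "((\<lambda>u. bilinear (u * x) (u * y)) \<longlongrightarrow> 0) (at_right 0)"
proof -
  let ?q = "\<lambda>j. \<Sum>k\<le>m+n-1. (- 1) ^ k * b k * f_exponent j ^ (k + 0)"
  define G' where "G' = (\<lambda>k. powr_series (0 + real m / real n * real 1) (real m / real n)
                     (\<lambda>j. g_coeff (j + 1) * g_exponent (j + 1) ^ k))"
  define F' where "F' = powr_series (\<alpha> + 1 - real m + 1 * real m) 1 (\<lambda>j. f_coeff (j + m) * ?q (j + m))"
  note entire_G = entire_coeffs_mult_linear_power[OF entire_g_coeff]
  note entire_F = entire_coeffs_mult_linear_power[OF entire_f_coeff]
  \<comment> \<open>The constant term of \<open>G 0\<close> has the exponent 0 and so disappears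
    from all higher \<open>G k\<close>. The remainder \<open>G' k\<close> starts with the exponent
    m/n.\<close>
  have Gsplit: "G k t = (if k = 0 then g_coeff 0 else 0) + G' k t" if "t > 0" for k t
    using powr_series_split_initial[OF entire_G[of 0 "real m / real n" k] that, of 0 "real m / real n" 1] that
    by (simp add: G_def G'_def power_0_left)
  have entire_F': "entire_coeffs (\<lambda>j. f_coeff j * ?q j)"
    by (rule powr_series_lincomb(2)[OF entire_f_coeff zero_less_one])
  have Fsum: "(\<Sum>k\<le>m+n-1. b k * ((- 1) ^ k * F k t)) = F' t" if "t > 0" for t
  proof -
    have "(\<Sum>k\<le>m+n-1. b k * ((- 1) ^ k * F k t)) =
        (\<Sum>k\<le>m+n-1. (- 1) ^ k * b k * powr_series (\<alpha> + 1 - real m) 1 (\<lambda>j. f_coeff j * f_exponent j ^ (k + 0)) t)"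
      by (simp add: F_def mult_ac)
    also have "\<dots> = powr_series (\<alpha> + 1 - real m) 1 (\<lambda>j. f_coeff j * ?q j) t"
      by (rule powr_series_lincomb[OF entire_f_coeff that])
    also have "\<dots> = F' t"
      unfolding F'_def
      by (rule powr_series_shift[OF entire_F' that])
        (use f_coeff_initial in simp)
    finally show ?thesis .
  qed
  \<comment> \<open>As m/n is at most m, the lower bound on \<alpha> is at least -1. The leading
    exponent \<alpha> + 1 of \<open>F'\<close> is therefore positive.\<close>
  have pos: "\<alpha> + 1 > 0"
  proof -
    have "real m / real n \<le> real m" using m n by (simp add: field_simps)
    with \<alpha> show ?thesis by simp
  qed
  have limF': "((\<lambda>u. F' (u * x)) \<longlongrightarrow> 0) (at_right 0)"
    unfolding F'_def
    by (rule tendsto_powr_series_scaled[OF entire_coeffs_shift[OF entire_F']]) (use assms pos in auto)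
  have limFG': "((\<lambda>u. F j (u * x) * G' k (u * y)) \<longlongrightarrow> 0) (at_right 0)" for j k
    unfolding F_def G'_def
    by (rule tendsto_powr_series_mult_scaled[OF entire_F _ _ entire_coeffs_shift[OF entire_G]])
      (use assms m n \<alpha> in auto)
  have "((\<lambda>u. g_coeff 0 * F' (u * x) + (\<Sum>k\<le>m+n-1. b k * (\<Sum>j\<le>k. (- 1) ^ j * (F j (u * x) * G' (k - j) (u * y))))) \<longlongrightarrow>
          g_coeff 0 * 0 + (\<Sum>k\<le>m+n-1. b k * (\<Sum>j\<le>k. (- 1) ^ j * 0))) (at_right 0)"
    by (intro tendsto_intros limF' limFG')
  then have "((\<lambda>u. g_coeff 0 * F' (u * x) + (\<Sum>k\<le>m+n-1. b k * (\<Sum>j\<le>k. (- 1) ^ j * (F j (u * x) * G' (k - j) (u * y))))) \<longlongrightarrow> 0) (at_right 0)"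
    by simp
  moreover have "g_coeff 0 * F' (u * x) + (\<Sum>k\<le>m+n-1. b k * (\<Sum>j\<le>k. (- 1) ^ j * (F j (u * x) * G' (k - j) (u * y)))) =
      bilinear (u * x) (u * y)" if "u > 0" for u
  proof -
    \<comment> \<open>The constant term of g survives only where g is not differentiated, at j = k.
      Summed over k with the weights \<open>b k\<close>, these terms form Q(-D) f, which is
      \<open>F'\<close>.\<close>
    have *: "(\<Sum>j\<le>k. (- 1) ^ j * F j (u * x) * G (k - j) (u * y)) =
           g_coeff 0 * ((- 1) ^ k * F k (u * x)) + (\<Sum>j\<le>k. (- 1) ^ j * (F j (u * x) * G' (k - j) (u * y)))" for k
    proof -
      have "(\<Sum>j\<le>k. (- 1) ^ j * F j (u * x) * G (k - j) (u * y)) =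
        (\<Sum>j\<le>k. (if k = j then g_coeff 0 * ((- 1) ^ j * F j (u * x)) else 0) + (- 1) ^ j * (F j (u * x) * G' (k - j) (u * y)))"
        using that assms by (intro sum.cong) (auto simp: Gsplit algebra_simps)
      then show ?thesis by (simp add: sum.distrib)
    qed
    show ?thesis
      unfolding bilinear_def * using that assms
      by (simp add: Fsum[symmetric] sum_distrib_left sum.distrib ring_distribs mult_ac)
  qed
  then have "\<forall>\<^sub>F u in at_right 0. g_coeff 0 * F' (u * x) + (\<Sum>k\<le>m+n-1. b k * (\<Sum>j\<le>k. (- 1) ^ j * (F j (u * x) * G' (k - j) (u * y)))) =
      bilinear (u * x) (u * y)"
    by (auto simp: eventually_at_right_field intro: exI[of _ 1])
  ultimately show ?thesis by (rule Lim_transform_eventually)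
qed

lemma wright_kernel_eq_bilinear:
  assumes "x > 0" "y > 0" "x \<noteq> y"
  shows "wright_kernel \<alpha> (real m / real n) x y =
           real m ^ m * real n ^ (n - 1) * x ^ (m - 1) * ((- 1) ^ (n + 1) * bilinear x y / (x ^ m - y ^ m))"
proof -
  let ?I = "\<lambda>u. wright_J ((\<alpha> + 1) / (real m / real n)) (1 / (real m / real n)) (u * x) *
               wright_J (\<alpha> + 1) (real m / real n) ((u * y) powr (real m / real n)) * u powr \<alpha>"
  \<comment> \<open>Everything in the derivative of the concomitant that is independent of
    u.\<close>
  define \<kappa> where "\<kappa> = ode_const * (y ^ m - x ^ m) * x powr (\<alpha> + 1 - real m)"
  \<comment> \<open>The value 0 at the origin is the limit there, which makes \<open>H\<close>
    continuous on the closed interval.\<close>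
  define H where "H = (\<lambda>u. if u \<le> 0 then 0 else bilinear (u * x) (u * y))"
  have deriv: "(H has_real_derivative \<kappa> * ?I u) (at u)" if "u > 0" for u
  proof -
    have "F 0 (u * x) * G 0 (u * y) * u ^ (m - 1) = x powr (\<alpha> + 1 - real m) * ?I u"
    proof -
      have "u powr (\<alpha> + 1 - real m) * u ^ (m - 1) = u powr \<alpha>"
        using that m by (simp add: of_nat_diff flip: powr_realpow powr_add)
      moreover have "F 0 (u * x) = (u * x) powr (\<alpha> + 1 - real m) *
          wright_J ((\<alpha> + 1) * real n / real m) (real n / real m) (u * x)"
        using euler_tower_F that assms by (simp add: euler_tower_def)
      moreover have "G 0 (u * y) = wright_J (\<alpha> + 1) (real m / real n) ((u * y) powr (real m / real n))"
        using euler_tower_G that assms by (simp add: euler_tower_def)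
      ultimately show ?thesis
        using that assms by (simp add: powr_mult)
    qed
    then have "ode_const * u ^ (m - 1) * (y ^ m - x ^ m) * (F 0 (u * x) * G 0 (u * y)) = \<kappa> * ?I u"
      unfolding \<kappa>_def by (simp add: mult_ac)
    with has_derivative_bilinear[OF assms(1,2) that]
    have "((\<lambda>u. bilinear (u * x) (u * y)) has_real_derivative \<kappa> * ?I u) (at u)" by simp
    then show ?thesis
      by (rule has_field_derivative_transform_within_open[OF _ open_greaterThan[of 0]]) (use that in \<open>auto simp: H_def\<close>)
  qed
  \<comment> \<open>The integrand may be unbounded at 0, since \<alpha> may be negative. This form
    of the fundamental theorem asks for the derivative in the interior only and yields integrability
    as well.\<close>
  have HI: "((\<lambda>u. \<kappa> * ?I u) has_integral H 1 - H 0) {0..1}"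
  proof (rule fundamental_theorem_of_calculus_interior)
    show "continuous_on {0..1} H"
      unfolding continuous_on_eq_continuous_within
    proof
      fix u :: real assume "u \<in> {0..1}"
      then consider "u = 0" | "u > 0" by force
      then show "continuous (at u within {0..1}) H"
      proof cases
        case 1
        have "(H \<longlongrightarrow> 0) (at_right 0)"
          by (rule Lim_transform_eventually[OF tendsto_bilinear[OF assms(1,2)]])
            (auto simp: H_def eventually_at_right_field intro: exI[of _ 1])
        then have "(H \<longlongrightarrow> 0) (at 0 within {0..1})"
          by (simp add: at_within_Icc_at_right)
        then show ?thesis
          by (simp add: 1 continuous_within H_def)
      next
        case 2
        then show ?thesis
          using deriv DERIV_isCont continuous_at_imp_continuous_at_within by blast
      qed
    qed
  qed (use deriv in \<open>auto simp flip: has_real_derivative_iff_has_vector_derivative\<close>)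
  have I: "\<kappa> * integral {0..1} ?I = bilinear x y"
    using integral_unique[OF HI] by (simp add: H_def)
  have pow: "x ^ m - y ^ m \<noteq> 0"
    using assms m power_eq_iff_eq_base[of m x y] by simp
  have c: "ode_const \<noteq> 0" using m n by (simp add: ode_const_def)
  have "wright_kernel \<alpha> (real m / real n) x y = real m / real n * x powr \<alpha> * integral {0..1} ?I"
    unfolding wright_kernel_def ..
  also have "\<dots> = real m / real n * x powr \<alpha> * (bilinear x y / \<kappa>)"
    using I[symmetric] c pow assms by (simp add: \<kappa>_def)
  also have "\<dots> = real m / real n * (x powr \<alpha> / x powr (\<alpha> + 1 - real m)) *
      (- 1 / ode_const) * (bilinear x y / (x ^ m - y ^ m))"
  proof -
    have "\<kappa> = - (ode_const * (x ^ m - y ^ m) * x powr (\<alpha> + 1 - real m))"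
      by (simp add: \<kappa>_def algebra_simps)
    then show ?thesis by simp
  qed
  also have "x powr \<alpha> / x powr (\<alpha> + 1 - real m) = x ^ (m - 1)"
    using assms m by (simp add: of_nat_diff flip: powr_realpow powr_diff)
  also have "real m / real n * x ^ (m - 1) * (- 1 / ode_const) =
      real m ^ m * real n ^ (n - 1) * x ^ (m - 1) * (- 1) ^ (n + 1)"
    using m n by (simp add: ode_const_def power_diff field_simps flip: power_mult_distrib)
  finally show ?thesis by simp
qed

lemma concomitant_eq_bilinear:
  assumes "x > 0" "y > 0"
  shows "concomitant m n \<alpha>
      (\<lambda>t. t powr (\<alpha> + 1 - real m) * wright_J ((\<alpha> + 1) * real n / real m) (real n / real m) t)
      (\<lambda>t. wright_J (\<alpha> + 1) (real m / real n) (t powr (real m / real n))) x y =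
    (- 1) ^ (n + 1) * bilinear x y"
  unfolding concomitant_euler_tower[OF euler_tower_F euler_tower_G assms] bilinear_def
  by (simp only: of_real_eq_id id_apply)

text \<open>Each Euler operator contributes 1/m under the substitution, and the j + (k - j)
  operators in a term of order k give 1/m^k, which is the scaling of \<open>b\<close>. The result is
  stated for a general field because the G-functions are complex while the Wright functions here are
  real.\<close>

lemma concomitant_tilde_eq_bilinear:
  fixes c d :: "'a::real_normed_field"
  assumes "x > 0" "y > 0" "\<kappa> > 0"
    and f: "\<And>t. t > 0 \<Longrightarrow> f t = c * of_real (F 0 (\<kappa> * t powr (1 / real m)))"
    and g: "\<And>t. t > 0 \<Longrightarrow> g t = d * of_real (G 0 (\<kappa> * t powr (1 / real m)))"
  shows "concomitant_tilde m n \<alpha> f g x y =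
    c * d * of_real ((- 1) ^ (n + 1) * bilinear (\<kappa> * x powr (1 / real m)) (\<kappa> * y powr (1 / real m)))"
proof -
  let ?F = "\<lambda>k t. c * of_real ((1 / real m) ^ k * F k (\<kappa> * t powr (1 / real m)))"
  let ?G = "\<lambda>k t. d * of_real ((1 / real m) ^ k * G k (\<kappa> * t powr (1 / real m)))"
  have tower: "euler_tower h (\<lambda>k t. e * of_real ((1 / real m) ^ k * H k (\<kappa> * t powr (1 / real m))))"
    if "euler_tower h' H" "\<And>t. t > 0 \<Longrightarrow> h t = e * of_real (H 0 (\<kappa> * t powr (1 / real m)))"
    for h :: "real \<Rightarrow> 'a" and h' H e
  proof (rule euler_tower_cong)
    show "euler_tower (\<lambda>t. e * of_real (h' (\<kappa> * t powr (1 / real m))))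
        (\<lambda>k t. e * of_real ((1 / real m) ^ k * H k (\<kappa> * t powr (1 / real m))))"
      by (intro euler_tower_mult euler_tower_of_real euler_tower_power_substitution that assms)
    show "e * of_real (h' (\<kappa> * t powr (1 / real m))) = h t" if "t > 0" for t
      using \<open>euler_tower h' H\<close> that \<open>\<kappa> > 0\<close> \<open>\<And>t. t > 0 \<Longrightarrow> h t = e * of_real (H 0 (\<kappa> * t powr (1 / real m)))\<close>
      by (simp add: euler_tower_def)
  qed
  have "concomitant_tilde m n \<alpha> f g x y = (- 1) ^ (n + 1) *
      (\<Sum>k\<le>m+n-1. of_real (b_coeff m n \<alpha> k) * (\<Sum>j\<le>k. (- 1) ^ j * ?F j x * ?G (k - j) y))"
    by (rule concomitant_tilde_euler_tower[OF tower[OF euler_tower_F f] tower[OF euler_tower_G g] assms(1,2)])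
  also have "(\<Sum>k\<le>m+n-1. of_real (b_coeff m n \<alpha> k) * (\<Sum>j\<le>k. (- 1) ^ j * ?F j x * ?G (k - j) y)) =
     c * d * of_real (bilinear (\<kappa> * x powr (1 / real m)) (\<kappa> * y powr (1 / real m)))"
    unfolding bilinear_def sum_distrib_left of_real_sum
  proof (intro sum.cong refl)
    fix k j :: nat assume "j \<in> {..k}"
    then have p: "(1 / real m) ^ j * (1 / real m) ^ (k - j) = 1 / real m ^ k"
      by (simp add: power_divide flip: power_add)
    have "of_real (b_coeff m n \<alpha> k) * ((- 1) ^ j * ?F j x * ?G (k - j) y) =
        c * d * of_real (b_coeff m n \<alpha> k * ((1 / real m) ^ j * (1 / real m) ^ (k - j)) *
          ((- 1) ^ j * F j (\<kappa> * x powr (1 / real m)) * G (k - j) (\<kappa> * y powr (1 / real m))))"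
      unfolding of_real_mult of_real_power of_real_minus of_real_1 by (simp only: mult_ac)
    also have "\<dots> = c * d * of_real (b k * ((- 1) ^ j * F j (\<kappa> * x powr (1 / real m)) *
            G (k - j) (\<kappa> * y powr (1 / real m))))"
      unfolding p by simp
    finally show "of_real (b_coeff m n \<alpha> k) * ((- 1) ^ j * ?F j x * ?G (k - j) y) =
        c * d * of_real (b k * ((- 1) ^ j * F j (\<kappa> * x powr (1 / real m)) *
            G (k - j) (\<kappa> * y powr (1 / real m))))" .
  qed
  finally show ?thesis by (simp add: mult_ac)
qed

end

section \<open>Hankel loop integrals of Gamma quotients\<close>

text \<open>The factor z + i has real part at most -(N - i), hence norm at least N - i.\<close>

lemma norm_pochhammer_ge_fact:
  fixes z :: complex
  assumes "Re z \<le> - real N"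
  shows "norm (pochhammer z N) \<ge> fact N"
proof -
  have "fact N = (\<Prod>i<N. real (N - i))"
    by (simp add: fact_prod_rev atLeast0LessThan)
  also have "\<dots> \<le> (\<Prod>i<N. norm (z + of_nat i))"
  proof (intro prod_mono conjI)
    fix i assume "i \<in> {..<N}"
    then show "real (N - i) \<le> norm (z + of_nat i)"
      using assms abs_Re_le_cmod[of "z + of_nat i"] by (simp add: of_nat_diff)
  qed auto
  finally show ?thesis
    by (simp add: pochhammer_prod atLeast0LessThan prod_norm)
qed

lemma complex_nonpos_Ints_iff:
  "z \<in> \<int>\<^sub>\<le>\<^sub>0 \<longleftrightarrow> (\<exists>k. z = - complex_of_nat k)"
  by (auto elim!: nonpos_Ints_cases')

locale gamma_quotient =
  fixes a p d q w :: real
  assumes p: "p > 0" and q: "q > 0" and w: "w > 0"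
begin

text \<open>The shape to which the multiplication theorem reduces the integrands of both
  G-functions; \<open>p\<close> and \<open>q\<close> are then m and n in one order or the
  other.\<close>

definition h :: "complex \<Rightarrow> complex" where
  "h u = Gamma (of_real a + of_real p * u) * rGamma (of_real d - of_real q * u) * of_real w powr (- u)"

definition pole :: "nat \<Rightarrow> complex" where
  "pole k = of_real (- ((real k + a) / p))"

(* minus the midpoint between the poles number N and N + 1 *)
definition cut :: "nat \<Rightarrow> real" where
  "cut N = (real N + 1 / 2 + a) / p"

lemma cut_left: "- cut N \<le> 1 - a / p"
proof -
  have "0 \<le> (real N + 1 / 2) / p" using p by simp
  then show ?thesis by (simp add: cut_def add_divide_distrib)
qed

lemma pole_iff: "of_real a + of_real p * u = - of_nat k \<longleftrightarrow> u = pole k"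
proof -
  have P: "of_real p * pole k = - of_nat k - of_real a"
    using p by (simp add: pole_def)
  have "of_real a + of_real p * u = - of_nat k \<longleftrightarrow> of_real p * u = of_real p * pole k"
    unfolding P eq_diff_eq by (simp add: add.commute)
  then show ?thesis using p by simp
qed

lemma nonpos_Ints_iff_pole: "of_real a + of_real p * u \<in> \<int>\<^sub>\<le>\<^sub>0 \<longleftrightarrow> u \<in> range pole"
  by (auto simp: complex_nonpos_Ints_iff pole_iff)

lemma holomorphic_h: "S \<inter> range pole = {} \<Longrightarrow> h holomorphic_on S"
  unfolding h_def using w nonpos_Ints_iff_pole
  by (intro holomorphic_intros) auto

lemma continuous_on_h: "S \<inter> range pole = {} \<Longrightarrow> continuous_on S h"
  by (intro holomorphic_on_imp_continuous_on holomorphic_h)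

lemma inj_pole: "inj pole"
  using p by (auto simp: inj_def pole_def)

text \<open>Gamma has the residue (-1)^k / k! at -k, and the linear change of variable divides it by
  p. The poles are spaced by 1/p, so the disc of this radius contains no other one.\<close>

lemma residue_h:
  "residue h (pole k) =
     of_real ((- 1) ^ k / fact k * rGamma (d + q * (real k + a) / p) * w powr ((real k + a) / p) / p)"
proof (rule residue_simple')
  show "open (ball (pole k) (1 / p))" "pole k \<in> ball (pole k) (1 / p)" using p by auto
  have "pole l \<notin> ball (pole k) (1 / p) - {pole k}" for l
  proof
    assume *: "pole l \<in> ball (pole k) (1 / p) - {pole k}"
    then have "l \<noteq> k" by auto
    have "dist (pole k) (pole l) = \<bar>(real l - real k) / p\<bar>"
      using p unfolding pole_def dist_of_real dist_real_def
      by (simp flip: diff_divide_distrib)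
    with * have "\<bar>real l - real k\<bar> < 1" using p by (simp add: divide_less_cancel)
    with \<open>l \<noteq> k\<close> show False by linarith
  qed
  then show "h holomorphic_on ball (pole k) (1 / p) - {pole k}"
    by (intro holomorphic_h) auto
  have lim: "filterlim (\<lambda>u. of_real a + of_real p * u) (at (- of_nat k)) (at (pole k))"
  proof (rule filterlim_atI)
    have "((\<lambda>u. of_real a + of_real p * u) \<longlongrightarrow> of_real a + of_real p * pole k) (at (pole k))"
      by (intro tendsto_intros)
    then show "((\<lambda>u. of_real a + of_real p * u) \<longlongrightarrow> - of_nat k) (at (pole k))"
      using pole_iff by metis
    show "\<forall>\<^sub>F u in at (pole k). of_real a + of_real p * u \<noteq> - of_nat k"
      by (simp add: pole_iff eventually_at_filter)
  qed
  have "isCont (\<lambda>u. rGamma (of_real d - of_real q * u)) (pole k)"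
    by (intro continuous_intros)
  then have lim_rGamma: "((\<lambda>u. rGamma (of_real d - of_real q * u)) \<longlongrightarrow> rGamma (of_real d - of_real q * pole k)) (at (pole k))"
    by (simp add: isCont_def)
  have "((\<lambda>u. Gamma (of_real a + of_real p * u) * (of_real a + of_real p * u + of_nat k) *
           (rGamma (of_real d - of_real q * u) * of_real w powr (- u) / of_real p)) \<longlongrightarrow>
         (- 1) ^ k / fact k * (rGamma (of_real d - of_real q * pole k) * of_real w powr (- pole k) / of_real p)) (at (pole k))"
    using p w by (intro tendsto_mult[OF filterlim_compose[OF Gamma_residues lim]] tendsto_intros lim_rGamma) auto
  moreover have "Gamma (of_real a + of_real p * u) * (of_real a + of_real p * u + of_nat k) *
           (rGamma (of_real d - of_real q * u) * of_real w powr (- u) / of_real p) = h u * (u - pole k)" for u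
    using p by (simp add: h_def pole_def field_simps)
  moreover have "(- 1) ^ k / fact k * (rGamma (of_real d - of_real q * pole k) * of_real w powr (- pole k) / of_real p) =
     complex_of_real ((- 1) ^ k / fact k * rGamma (d + q * (real k + a) / p) * w powr ((real k + a) / p) / p)"
  proof -
    have "d - q * (- ((real k + a) / p)) = d + q * (real k + a) / p"
      using p by (simp add: field_simps)
    then have "complex_of_real d - of_real q * pole k = of_real (d + q * (real k + a) / p)"
      unfolding pole_def by (simp only: flip: of_real_mult of_real_diff)
    moreover have "complex_of_real w powr (- pole k) = of_real (w powr ((real k + a) / p))"
      using w powr_of_real[of w "(real k + a) / p"] by (simp add: pole_def)
    ultimately show ?thesis by (simp only: rGamma_complex_of_real) simp
  qed
  ultimately show "((\<lambda>u. h u * (u - pole k)) \<longlongrightarrow>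
     complex_of_real ((- 1) ^ k / fact k * rGamma (d + q * (real k + a) / p) * w powr ((real k + a) / p) / p)) (at (pole k))"
    by (simp only:)
qed

lemma contour_integral_rectpath_h:
  "contour_integral (rectpath (Complex (- cut N) (- 1)) (Complex (1 - a / p) 1)) h =
     2 * of_real pi * \<i> * (\<Sum>k\<le>N. residue h (pole k))"
proof -
  let ?g = "rectpath (Complex (- cut N) (- 1)) (Complex (1 - a / p) 1)"
  \<comment> \<open>The half-plane to the right of pole number N + 1: it is convex, contains the
    closed rectangle, and meets only the poles 0 to N.\<close>
  define S where "S = {u. Re u > - ((real N + 1 + a) / p)}"
  note le = cut_left[of N]
  have in_box: "pole k \<in> box (Complex (- cut N) (- 1)) (Complex (1 - a / p) 1)" if "k \<le> N" for k
  proof -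
    have "(real k + a) / p < cut N"
      unfolding cut_def using that p by (intro divide_strict_right_mono) auto
    moreover have "- ((real k + a) / p) < 1 - a / p"
    proof -
      have "0 \<le> real k / p" using p by simp
      then show ?thesis by (simp add: add_divide_distrib)
    qed
    ultimately show ?thesis by (simp add: in_box_complex_iff pole_def)
  qed
  have "S \<inter> range pole \<subseteq> pole ` {..N}"
  proof
    fix u assume "u \<in> S \<inter> range pole"
    then obtain k where k: "u = pole k" "pole k \<in> S" by auto
    then have "(real k + a) / p < (real N + 1 + a) / p" by (simp add: S_def pole_def)
    then have "k \<le> N" using p by (simp add: divide_less_cancel)
    with k show "u \<in> pole ` {..N}" by auto
  qed
  have path: "path_image ?g \<subseteq> S - pole ` {..N}"
  proof -
    have "cbox (Complex (- cut N) (- 1)) (Complex (1 - a / p) 1) \<subseteq> S"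
    proof -
      have "- ((real N + 1 + a) / p) < - cut N"
        using p by (simp add: cut_def field_simps)
      then show ?thesis by (auto simp: S_def in_cbox_complex_iff)
    qed
    then show ?thesis
      using le in_box by (auto simp: path_image_rectpath_cbox_minus_box)
  qed
  have "contour_integral ?g h = 2 * pi * \<i> * (\<Sum>u\<in>pole ` {..N}. winding_number ?g u * residue h u)"
  proof (rule Residue_theorem)
    show "open S" "connected S"
      unfolding S_def by (auto intro!: open_halfspace_Re_gt convex_connected convex_halfspace_Re_gt)
    show "h holomorphic_on S - pole ` {..N}"
      using \<open>S \<inter> range pole \<subseteq> pole ` {..N}\<close> by (intro holomorphic_h) blast
    show "\<forall>z. z \<notin> S \<longrightarrow> winding_number ?g z = 0"
    proof (intro allI impI winding_number_rectpath_outside)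
      fix z assume "z \<notin> S"
      then show "z \<notin> cbox (Complex (- cut N) (- 1)) (Complex (1 - a / p) 1)"
        using p by (auto simp: S_def in_cbox_complex_iff cut_def field_simps)
    qed (use le in auto)
  qed (use path in auto)
  also have "(\<Sum>u\<in>pole ` {..N}. winding_number ?g u * residue h u) = (\<Sum>k\<le>N. residue h (pole k))"
    using in_box by (subst sum.reindex) (auto intro: inj_on_subset[OF inj_pole] simp: winding_number_rectpath)
  finally show ?thesis by simp
qed

text \<open>Translation by N carries the edges into a compact set independent of N. The recursion of
  Gamma then contributes 1/N!, the power of w contributes \<rho>^N, and the other Gamma factor stays
  in a half strip.\<close>

lemma h_bound_left:
  obtains C \<rho> where "C > 0" "\<rho> > 0"
    "\<And>N u. - cut (N + 1) \<le> Re u \<Longrightarrow> Re u \<le> - cut N \<Longrightarrow> \<bar>Im u\<bar> \<le> 1 \<Longrightarrow>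
            Re u = - cut N \<or> \<bar>Im u\<bar> = 1 \<Longrightarrow> norm (h u) \<le> C * (\<rho> ^ N / fact N)"
proof -
  \<comment> \<open>These three segments contain the images of the left edge and of the two
    horizontal pieces under u -> a + p u + N. They avoid the poles of Gamma: the first lies at the
    real part -1/2, the others off the real axis.\<close>
  define K where "K = cbox (Complex (-1/2) (-p)) (Complex (-1/2) p) \<union>
                   cbox (Complex (-3/2) p) (Complex (-1/2) p) \<union>
                   cbox (Complex (-3/2) (-p)) (Complex (-1/2) (-p))"
  let ?k = "\<lambda>z. Gamma z * of_real w powr ((of_real a - z) / of_real p)"
  have K_Ints: "K \<inter> \<int>\<^sub>\<le>\<^sub>0 = {}"
  proof -
    have "Re z \<noteq> -1/2 \<and> Im z = 0" if z: "z \<in> \<int>\<^sub>\<le>\<^sub>0" for z :: complex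
    proof -
      obtain k :: nat where "z = - of_nat k" using z by (auto simp: complex_nonpos_Ints_iff)
      moreover have "real k \<noteq> 1 / 2"
      proof
        assume "real k = 1 / 2"
        then have "real (2 * k) = real 1" by simp
        then have "2 * k = 1" by (simp only: of_nat_eq_iff)
        then show False by presburger
      qed
      ultimately show ?thesis by simp
    qed
    moreover have "Re z = -1/2 \<or> Im z = p \<or> Im z = - p" if "z \<in> K" for z
      using that by (auto simp: K_def in_cbox_complex_iff)
    ultimately show ?thesis
      using p by (metis disjoint_iff less_irrefl neg_0_equal_iff_equal)
  qed
  have "continuous_on K ?k"
    using K_Ints w p by (intro continuous_intros) auto
  moreover have "compact K"
    by (simp add: K_def compact_Un)
  ultimately have "bounded (?k ` K)"
    by (intro compact_imp_bounded compact_continuous_image)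
  then obtain A where A: "A > 0" "\<And>z. z \<in> K \<Longrightarrow> norm (?k z) \<le> A"
    unfolding bounded_pos by blast
  obtain B where B: "B > 0" "\<And>z. Re z \<ge> d + q * cut 0 \<Longrightarrow> \<bar>Im z\<bar> \<le> q \<Longrightarrow> norm (rGamma z) \<le> B"
    using rGamma_bounded_half_strip[of "d + q * cut 0" q] by metis
  define \<rho> where "\<rho> = w powr (1 / p)"
  have "norm (h u) \<le> A * B * (\<rho> ^ N / fact N)"
    if u: "- cut (N + 1) \<le> Re u" "Re u \<le> - cut N" "\<bar>Im u\<bar> \<le> 1"
      "Re u = - cut N \<or> \<bar>Im u\<bar> = 1" for N u
  proof -
    define z where "z = of_real a + of_real p * u + of_nat N"
    have Re_z: "Re z = a + p * Re u + real N" and Im_z: "Im z = p * Im u"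
      by (simp_all add: z_def)
    have "p * (- cut (N + 1)) \<le> p * Re u" "p * Re u \<le> p * (- cut N)"
      using u p by (simp_all only: mult_le_cancel_left_pos)
    then have z1: "- 3 / 2 \<le> Re z" "Re z \<le> - 1 / 2"
      using p by (simp_all add: Re_z cut_def)
    have z2: "\<bar>Im z\<bar> \<le> p"
      using u(3) p by (simp add: Im_z abs_mult)
    have z3: "Re z = - 1 / 2 \<or> \<bar>Im z\<bar> = p"
      using u(4) p by (auto simp: Re_z Im_z cut_def abs_mult)
    have "z \<in> K"
      using z1 z2 z3 by (auto simp: K_def in_cbox_complex_iff)
    have u_z: "u = (z - of_nat N - of_real a) / of_real p"
      using p by (simp add: z_def)
    have poch: "norm (pochhammer (z - of_nat N) N) \<ge> fact N"
      using z1 by (intro norm_pochhammer_ge_fact) simp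
    \<comment> \<open>N steps of the recursion bring the argument back into \<open>K\<close>; the
      Pochhammer symbol in the denominator has norm at least N!.\<close>
    have G: "Gamma (of_real a + of_real p * u) = Gamma z / pochhammer (z - of_nat N) N"
      using pochhammer_rGamma[of "z - of_nat N" N]
      by (simp add: z_def Gamma_def divide_inverse mult.commute)
    have "cut 0 \<le> cut N" using p by (simp add: cut_def divide_right_mono)
    then have "Re u \<le> - cut 0" using u(2) by simp
    then have "q * Re u \<le> q * - cut 0"
      using q by (intro mult_left_mono) auto
    moreover have "\<bar>q * Im u\<bar> \<le> q * 1"
      using q u(3) unfolding abs_mult by (intro mult_mono) auto
    ultimately have G': "norm (rGamma (of_real d - of_real q * u)) \<le> B"
      by (intro B) simp_all
    have P: "complex_of_real w powr (- u) = of_real w powr ((of_real a - z) / of_real p) * of_real (\<rho> ^ N)"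
    proof -
      have "- u = (of_real a - z) / of_real p + of_real (real N / p)"
        using p by (simp add: u_z field_simps)
      moreover have "complex_of_real w powr of_real (real N / p) = of_real (\<rho> ^ N)"
        using w powr_of_real[of w "real N / p"]
        by (simp add: \<rho>_def powr_powr flip: powr_realpow)
      ultimately show ?thesis by (simp only: powr_add)
    qed
    have "norm (h u) = norm (?k z) / norm (pochhammer (z - of_nat N) N) * norm (rGamma (of_real d - of_real q * u)) * \<rho> ^ N"
      unfolding h_def G P by (simp add: norm_mult norm_divide norm_power \<rho>_def)
    also have "\<dots> \<le> A / fact N * norm (rGamma (of_real d - of_real q * u)) * \<rho> ^ N"
      using A \<open>z \<in> K\<close> poch by (intro mult_right_mono frac_le) (auto simp: \<rho>_def)
    also have "\<dots> \<le> A / fact N * B * \<rho> ^ N"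
      using A by (intro mult_right_mono mult_left_mono G') (auto simp: \<rho>_def)
    finally show ?thesis by (simp add: mult_ac)
  qed
  moreover have "\<rho> > 0" using w by (simp add: \<rho>_def)
  ultimately show thesis using A(1) B(1) by (intro that[of "A * B" \<rho>]) auto
qed

lemma continuous_on_h_vertical:
  assumes "complex_of_real r \<notin> range pole"
  shows "continuous_on (closed_segment (Complex r s) (Complex r s')) h"
proof (intro continuous_on_h)
  have "u \<notin> range pole" if "Re u = r" for u
    using that assms by (auto simp: pole_def image_iff)
  then show "closed_segment (Complex r s) (Complex r s') \<inter> range pole = {}"
    by (auto simp: closed_segment_same_Re)
qed

lemma continuous_on_h_cut: "continuous_on (closed_segment (Complex (- cut N) s) (Complex (- cut N) s')) h"
proof (rule continuous_on_h_vertical)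
  show "complex_of_real (- cut N) \<notin> range pole"
  proof -
    have "cut N \<noteq> (real k + a) / p" for k
    proof
      assume "cut N = (real k + a) / p"
      then have "real (2 * N + 1) = real (2 * k)" using p by (simp add: cut_def)
      then have "2 * N + 1 = 2 * k" by (simp only: of_nat_eq_iff)
      then show False by presburger
    qed
    then show ?thesis by (auto simp: pole_def image_iff simp del: of_real_minus of_real_divide of_real_add)
  qed
qed

lemma continuous_on_h_right:
  "continuous_on (closed_segment (Complex (1 - a / p) s) (Complex (1 - a / p) s')) h"
proof (rule continuous_on_h_vertical)
  have "1 - a / p \<noteq> - ((real k + a) / p)" for k
  proof -
    have "0 \<le> real k / p" using p by simp
    then show ?thesis by (simp add: add_divide_distrib)
  qed
  then show "complex_of_real (1 - a / p) \<notin> range pole"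
    by (auto simp: pole_def image_iff simp del: of_real_minus of_real_divide of_real_add of_real_diff)
qed

lemma continuous_on_h_horizontal:
  "s \<noteq> 0 \<Longrightarrow> continuous_on (closed_segment (Complex r s) (Complex r' s)) h"
  by (intro continuous_on_h) (auto simp: closed_segment_same_Im pole_def)

lemmas contour_integrable_h =
  continuous_on_h_horizontal[THEN contour_integrable_continuous_linepath]
  continuous_on_h_cut[THEN contour_integrable_continuous_linepath]
  continuous_on_h_right[THEN contour_integrable_continuous_linepath]

lemma contour_integrable_h_hankel_loop: "h contour_integrable_on hankel_loop (1 - a / p) R"
  unfolding hankel_loop_def by (simp add: contour_integrable_h)

text \<open>The loop and the rectangle share their right part. The loop has two additional
  horizontal tails, and the rectangle has an additional left edge, hence the minus sign.\<close>

lemma hankel_loop_eq_rectpath: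
  assumes "cut N \<le> R"
  defines "c \<equiv> 1 - a / p"
  shows "contour_integral (hankel_loop c R) h =
           contour_integral (rectpath (Complex (- cut N) (- 1)) (Complex c 1)) h
           + contour_integral (linepath (Complex (- R) (- 1)) (Complex (- cut N) (- 1))) h
           + contour_integral (linepath (Complex (- cut N) 1) (Complex (- R) 1)) h
           - contour_integral (linepath (Complex (- cut N) 1) (Complex (- cut N) (- 1))) h"
proof -
  have "- cut N \<le> c" unfolding c_def by (rule cut_left)
  have loop: "contour_integral (hankel_loop c R) h =
      contour_integral (linepath (Complex (- R) (- 1)) (Complex c (- 1))) h +
      (contour_integral (linepath (Complex c (- 1)) (Complex c 1)) h +
       contour_integral (linepath (Complex c 1) (Complex (- R) 1)) h)"
    unfolding hankel_loop_def c_def by (simp add: contour_integrable_h)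
  have rect: "contour_integral (rectpath (Complex (- cut N) (- 1)) (Complex c 1)) h =
      contour_integral (linepath (Complex (- cut N) (- 1)) (Complex c (- 1))) h +
      (contour_integral (linepath (Complex c (- 1)) (Complex c 1)) h +
       (contour_integral (linepath (Complex c 1) (Complex (- cut N) 1)) h +
       contour_integral (linepath (Complex (- cut N) 1) (Complex (- cut N) (- 1))) h))"
    unfolding rectpath_def c_def by (simp add: contour_integrable_h Let_def)
  have "contour_integral (linepath (Complex (- R) (- 1)) (Complex c (- 1))) h =
      contour_integral (linepath (Complex (- R) (- 1)) (Complex (- cut N) (- 1))) h +
      contour_integral (linepath (Complex (- cut N) (- 1)) (Complex c (- 1))) h"
    using assms(1) \<open>- cut N \<le> c\<close>
    by (intro contour_integral_split_linepath continuous_on_h_horizontal) (auto simp: closed_segment_same_Im closed_segment_eq_real_ivl)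
  moreover have "contour_integral (linepath (Complex c 1) (Complex (- R) 1)) h =
      contour_integral (linepath (Complex c 1) (Complex (- cut N) 1)) h +
      contour_integral (linepath (Complex (- cut N) 1) (Complex (- R) 1)) h"
    using assms(1) \<open>- cut N \<le> c\<close>
    by (intro contour_integral_split_linepath continuous_on_h_horizontal) (auto simp: closed_segment_same_Im closed_segment_eq_real_ivl)
  ultimately show ?thesis unfolding loop rect by simp
qed

text \<open>The k-th residue carries w^((k + a)/p), so the sum is a series with leading exponent a/p
  and step 1/p, which is a power times a Wright function.\<close>

lemma sums_residue_h:
  "(\<lambda>k. residue h (pole k)) sums
     of_real (w powr (a / p) * wright_J (d + q * a / p) (q / p) (w powr (1 / p)) / p)"
proof -
  let ?c = "\<lambda>j. (- 1) ^ j / fact j * rGamma (d + q * a / p + q / p * real j)"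
  have "entire_coeffs ?c"
    using p q by (intro entire_coeffs_wright) simp
  from sums_powr_series[OF this w, of "a / p" "1 / p"]
  have "(\<lambda>j. ?c j * w powr (a / p + 1 / p * real j) / p) sums
      (w powr (a / p) * wright_J (d + q * a / p) (q / p) (w powr (1 / p)) / p)"
    unfolding powr_mult_wright_J by (rule sums_divide)
  then have "(\<lambda>j. complex_of_real (?c j * w powr (a / p + 1 / p * real j) / p)) sums
      of_real (w powr (a / p) * wright_J (d + q * a / p) (q / p) (w powr (1 / p)) / p)"
    unfolding sums_of_real_iff .
  moreover have "residue h (pole j) = of_real (?c j * w powr (a / p + 1 / p * real j) / p)" for j
  proof -
    have "d + q * (real j + a) / p = d + q * a / p + q / p * real j"
      "(real j + a) / p = a / p + 1 / p * real j"
      using p by (simp_all add: field_simps)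
    then show ?thesis unfolding residue_h by (simp only:)
  qed
  ultimately show ?thesis by simp
qed

lemma tendsto_contour_integral_hankel_loop:
  "((\<lambda>R. contour_integral (hankel_loop (1 - a / p) R) h) \<longlongrightarrow>
     2 * of_real pi * \<i> * of_real (w powr (a / p) * wright_J (d + q * a / p) (q / p) (w powr (1 / p)) / p)) at_top"
proof -
  \<comment> \<open>For large R this is the index with R between \<open>cut (N R)\<close> and
    \<open>cut (N R + 1)\<close>, so that the tails are no longer than the spacing 1/p of the
    poles.\<close>
  define N where "N = (\<lambda>R. nat \<lfloor>p * R - a - 1 / 2\<rfloor>)"
  define s where "s = (\<lambda>n. 2 * of_real pi * \<i> * (\<Sum>k\<le>n. residue h (pole k)))"
  obtain C \<rho> where C: "C > 0" "\<rho> > 0"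
    "\<And>N u. - cut (N + 1) \<le> Re u \<Longrightarrow> Re u \<le> - cut N \<Longrightarrow> \<bar>Im u\<bar> \<le> 1 \<Longrightarrow>
            Re u = - cut N \<or> \<bar>Im u\<bar> = 1 \<Longrightarrow> norm (h u) \<le> C * (\<rho> ^ N / fact N)"
    using h_bound_left by metis
  have "\<forall>\<^sub>F R in at_top. N R \<ge> n" for n
  proof -
    have "\<forall>\<^sub>F R in at_top. R \<ge> (real n + a + 1 / 2) / p" by (rule eventually_ge_at_top)
    then show ?thesis
    proof eventually_elim
      case (elim R)
      then have "real n \<le> p * R - a - 1 / 2" using p by (simp add: field_simps)
      then show ?case by (simp add: N_def le_nat_floor le_nat_iff le_floor_iff)
    qed
  qed
  then have N_lim: "filterlim N at_top at_top"
    by (simp add: filterlim_at_top)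
  \<comment> \<open>The constant is the total length of the contour not shared with the rectangle:
    two tails of length at most 1/p and a left edge of length 2.\<close>
  have dist: "norm (contour_integral (hankel_loop (1 - a / p) R) h - s n) \<le>
                (2 / p + 2) * (C * (\<rho> ^ n / fact n))"
    if R: "cut n \<le> R" "R \<le> cut (n + 1)" for R n
  proof -
    let ?M = "C * (\<rho> ^ n / fact n)"
    have M: "?M \<ge> 0" using C by simp
    have len: "R - cut n \<le> 1 / p"
      using R(2) p by (simp add: cut_def add_divide_distrib)
    have "cut n \<le> cut (n + 1)" using R by simp
    have I1: "norm (contour_integral (linepath (Complex r t) (Complex r' t)) h) \<le> ?M * (1 / p)"
      if "{r, r'} = {- R, - cut n}" "\<bar>t\<bar> = 1" for r r' t
    proof -
      have "norm (contour_integral (linepath (Complex r t) (Complex r' t)) h) \<le>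
              ?M * norm (Complex r' t - Complex r t)"
      proof (rule contour_integral_bound_linepath[OF contour_integrable_continuous_linepath M])
        show "continuous_on (closed_segment (Complex r t) (Complex r' t)) h"
          using that by (intro continuous_on_h_horizontal) auto
        fix u assume "u \<in> closed_segment (Complex r t) (Complex r' t)"
        then show "norm (h u) \<le> ?M"
          using that R by (intro C(3)) (auto simp: closed_segment_same_Im closed_segment_eq_real_ivl doubleton_eq_iff split: if_splits)
      qed
      moreover have "norm (Complex r' t - Complex r t) \<le> 1 / p"
        using that R len by (auto simp: cmod_def doubleton_eq_iff)
      ultimately show ?thesis
        by (rule order_trans[OF _ mult_left_mono[OF _ M]])
    qed
    have I2: "norm (contour_integral (linepath (Complex (- cut n) 1) (Complex (- cut n) (- 1))) h) \<le> ?M * 2"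
    proof -
      have "norm (contour_integral (linepath (Complex (- cut n) 1) (Complex (- cut n) (- 1))) h) \<le>
              ?M * norm (Complex (- cut n) (- 1) - Complex (- cut n) 1)"
      proof (rule contour_integral_bound_linepath[OF contour_integrable_continuous_linepath M])
        show "continuous_on (closed_segment (Complex (- cut n) 1) (Complex (- cut n) (- 1))) h"
          by (rule continuous_on_h_cut)
        fix u assume "u \<in> closed_segment (Complex (- cut n) 1) (Complex (- cut n) (- 1))"
        then show "norm (h u) \<le> ?M"
          using \<open>cut n \<le> cut (n + 1)\<close>
          by (intro C(3)) (auto simp: closed_segment_same_Re closed_segment_eq_real_ivl)
      qed
      then show ?thesis by (simp add: cmod_def)
    qed
    let ?A = "contour_integral (linepath (Complex (- R) (- 1)) (Complex (- cut n) (- 1))) h"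
    let ?B = "contour_integral (linepath (Complex (- cut n) 1) (Complex (- R) 1)) h"
    let ?D = "contour_integral (linepath (Complex (- cut n) 1) (Complex (- cut n) (- 1))) h"
    have "contour_integral (hankel_loop (1 - a / p) R) h - s n = ?A + ?B - ?D"
      unfolding hankel_loop_eq_rectpath[OF R(1)] contour_integral_rectpath_h s_def by simp
    then have "norm (contour_integral (hankel_loop (1 - a / p) R) h - s n) = norm (?A + ?B - ?D)"
      by (rule arg_cong)
    also have "\<dots> \<le> norm ?A + norm ?B + norm ?D"
      using norm_triangle_ineq4[of "?A + ?B" ?D] norm_triangle_ineq[of ?A ?B] by linarith
    also have "\<dots> \<le> ?M * (1 / p) + ?M * (1 / p) + ?M * 2"
      by (rule add_mono[OF add_mono[OF I1 I1] I2]) auto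
    also have "\<dots> = (2 / p + 2) * ?M" by (simp add: algebra_simps)
    finally show ?thesis .
  qed
  have M_lim: "(\<lambda>n. (2 / p + 2) * (C * (\<rho> ^ n / fact n))) \<longlonglongrightarrow> (2 / p + 2) * (C * 0)"
    using summable_LIMSEQ_zero[OF summable_exp[of \<rho>]]
    by (intro tendsto_mult tendsto_const) (simp add: divide_inverse mult.commute)
  have bound_lim: "((\<lambda>R. (2 / p + 2) * (C * (\<rho> ^ N R / fact (N R)))) \<longlongrightarrow> 0) at_top"
    using filterlim_compose[OF M_lim N_lim] by simp
  have diff_lim: "((\<lambda>R. contour_integral (hankel_loop (1 - a / p) R) h - s (N R)) \<longlongrightarrow> 0) at_top"
  proof (rule Lim_null_comparison[OF _ bound_lim])
    have "\<forall>\<^sub>F R in at_top. R \<ge> (a + 1 / 2) / p" by (rule eventually_ge_at_top)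
    then show "\<forall>\<^sub>F R in at_top. norm (contour_integral (hankel_loop (1 - a / p) R) h - s (N R)) \<le>
        (2 / p + 2) * (C * (\<rho> ^ N R / fact (N R)))"
    proof eventually_elim
      case (elim R)
      then have "p * R - a - 1 / 2 \<ge> 0" using p by (simp add: field_simps)
      then have "real (N R) \<le> p * R - a - 1 / 2" "p * R - a - 1 / 2 \<le> real (N R) + 1"
        unfolding N_def by linarith+
      then show ?case using p by (intro dist) (simp_all add: cut_def field_simps)
    qed
  qed
  have "s \<longlonglongrightarrow> 2 * of_real pi * \<i> * of_real (w powr (a / p) * wright_J (d + q * a / p) (q / p) (w powr (1 / p)) / p)"
    unfolding s_def using sums_residue_h by (intro tendsto_mult tendsto_const) (simp add: sums_def_le)
  from tendsto_add[OF diff_lim filterlim_compose[OF this N_lim]] show ?thesis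
    by simp
qed

end

section \<open>Meijer G-functions and the kernel formulas\<close>

context gamma_quotient
begin

text \<open>The second assumption places the rightmost pole at -a/p, so the loop in
  \<open>meijer_G\<close> crosses the real axis at 1 - a/p, on the right edge of the
  rectangles.\<close>

lemma meijer_G_eq_wright_J:
  assumes "\<And>u. meijer_G_integrand k bs z u = D * h u"
    and "Max ((\<lambda>j. - bs ! j) ` {..<k}) = - a / p"
  shows "meijer_G k bs z =
     D * of_real (w powr (a / p) * wright_J (d + q * a / p) (q / p) (w powr (1 / p)) / p)"
proof -
  let ?v = "of_real (w powr (a / p) * wright_J (d + q * a / p) (q / p) (w powr (1 / p)) / p) :: complex"
  have c: "1 + Max ((\<lambda>j. - bs ! j) ` {..<k}) = 1 - a / p"
    using assms(2) by simp
  have integrand: "meijer_G_integrand k bs z = (\<lambda>u. D * h u)"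
    using assms(1) by auto
  have "((\<lambda>R. D * contour_integral (hankel_loop (1 - a / p) R) h) \<longlongrightarrow> D * (2 * of_real pi * \<i> * ?v)) at_top"
    by (intro tendsto_mult tendsto_const tendsto_contour_integral_hankel_loop)
  then have "Lim at_top (\<lambda>R. contour_integral (hankel_loop (1 - a / p) R) (\<lambda>u. D * h u)) =
      D * (2 * of_real pi * \<i> * ?v)"
    by (intro tendsto_Lim) (simp_all add: contour_integral_lmul contour_integrable_h_hankel_loop)
  moreover have "1 / \<omega> * (D * (\<omega> * v)) = D * v" if "\<omega> \<noteq> 0" for \<omega> v :: complex
    using that by simp
  from this[of "2 * of_real pi * \<i>"]
  have "1 / (2 * of_real pi * \<i>) * (D * (2 * of_real pi * \<i> * v)) = D * v" for v
    by (simp only: mult_eq_0_iff) simp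
  ultimately show ?thesis
    unfolding meijer_G_def c integrand by (simp only:)
qed

end

section \<open>The rescaled variable and the two G-functions\<close>

context wright_parameters
begin

text \<open>Chosen such that the m-th power of \<open>scale * t powr (1 / real m)\<close> is m^m n^n
  t. This is the argument \<open>w\<close> that the multiplication theorem produces from t, and it
  makes the difference of m-th powers a multiple of x - y.\<close>

definition scale :: real where
  "scale = real m * real n powr (real n / real m)"

lemma scale_pos: "scale > 0"
  using m n by (simp add: scale_def)

lemma scale_power:
  assumes "t > 0"
  shows "(scale * t powr (1 / real m)) ^ m = real m ^ m * real n ^ n * t"
proof -
  have "(real n powr (real n / real m)) ^ m = real n ^ n" "(t powr (1 / real m)) ^ m = t"
    using m n assms by (simp_all add: powr_powr flip: powr_realpow)
  then show ?thesis by (simp add: scale_def power_mult_distrib)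
qed

lemma wright_kernel_scale:
  assumes "x > 0" "y > 0" "x \<noteq> y"
  shows "wright_kernel \<alpha> (real m / real n) (scale * x powr (1 / real m)) (scale * y powr (1 / real m)) =
    scale ^ (m - 1) * x powr (1 - 1 / real m) / real n *
      ((- 1) ^ (n + 1) * bilinear (scale * x powr (1 / real m)) (scale * y powr (1 / real m)) / (x - y))"
proof -
  let ?X = "scale * x powr (1 / real m)" and ?Y = "scale * y powr (1 / real m)"
  let ?B = "(- 1) ^ (n + 1) * bilinear ?X ?Y"
  have pow: "?X ^ m - ?Y ^ m = real m ^ m * real n ^ n * (x - y)"
    unfolding scale_power[OF assms(1)] scale_power[OF assms(2)] by (simp add: algebra_simps)
  have "?X \<noteq> ?Y"
    using pow assms m n by auto
  have "1 / real m * (real m - 1) = 1 - 1 / real m"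
    using m by (simp add: field_simps)
 then have "(x powr (1 / real m)) ^ (m - 1) = x powr (1 - 1 / real m)"
    using assms m powr_realpow[of "x powr (1 / real m)" "m - 1"] by (simp add: powr_powr of_nat_diff)
  then have X: "?X ^ (m - 1) = scale ^ (m - 1) * x powr (1 - 1 / real m)"
    by (simp add: power_mult_distrib)
  have "real n ^ n = real n * real n ^ (n - 1)"
    using n by (simp add: power_eq_if)
  then have cancel: "real m ^ m * real n ^ (n - 1) * Z * (?B / (real m ^ m * real n ^ n * (x - y))) =
      Z / real n * (?B / (x - y))" for Z
    using m n assms by (simp add: field_simps)
  have "wright_kernel \<alpha> (real m / real n) ?X ?Y =
      real m ^ m * real n ^ (n - 1) * (scale ^ (m - 1) * x powr (1 - 1 / real m)) * (?B / (real m ^ m * real n ^ n * (x - y)))"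
    unfolding pow[symmetric] X[symmetric]
    by (rule wright_kernel_eq_bilinear) (use \<open>?X \<noteq> ?Y\<close> scale_pos assms in auto)
  then show ?thesis unfolding cancel .
qed

lemma ln_scale:
  assumes "t > 0"
  shows "ln ((scale * t powr (1 / real m)) powr real m) = real m * ln (real m) + real n * ln (real n) + ln t"
  using assms m n by (simp add: scale_def ln_mult ln_powr field_simps)

lemma F_0_eq:
  "t > 0 \<Longrightarrow> F 0 t = t powr (\<alpha> + 1 - real m) * wright_J ((\<alpha> + 1) * real n / real m) (real n / real m) t"
  using euler_tower_F by (simp add: euler_tower_def)

lemma G_0_eq: "t > 0 \<Longrightarrow> G 0 t = wright_J (\<alpha> + 1) (real m / real n) (t powr (real m / real n))"
  using euler_tower_G by (simp add: euler_tower_def)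

lemma wright_F_eq:
  assumes "t > 0"
  shows "(t powr real m) powr ((\<alpha> + 1 - real m) / real m) *
           wright_J (real n + real n * (\<alpha> + 1 - real m) / real m) (real n / real m) ((t powr real m) powr (1 / real m)) = F 0 t"
proof -
  have "real n + real n * (\<alpha> + 1 - real m) / real m = (\<alpha> + 1) * real n / real m"
    using m by (simp add: field_simps)
  moreover have "F 0 t = t powr (\<alpha> + 1 - real m) * wright_J ((\<alpha> + 1) * real n / real m) (real n / real m) t"
    using euler_tower_F assms by (simp add: euler_tower_def)
  ultimately show ?thesis
    using assms m by (simp add: powr_powr)
qed

text \<open>The left side is the residue sum for a = 0 and p = n as it stands, including the trivial
  \<open>0 / real n\<close>.\<close>

lemma wright_G_eq:
  assumes "t > 0"
  shows "(t powr real m) powr (0 / real n) *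
           wright_J (\<alpha> + 1 + real m * 0 / real n) (real m / real n) ((t powr real m) powr (1 / real n)) = G 0 t"
  using euler_tower_G assms by (simp add: euler_tower_def powr_powr)

text \<open>The constants of the multiplication theorem enter \<open>c\<close> as Dn / Dm and
  \<open>d\<close> as Dm / Dn, so the product is explicit although neither factor is.\<close>

lemma meijer_G_eq_F_G:
  obtains c d :: complex where "c * d = of_real (real m ^ (m - 1) * real n ^ (n - 1))"
    "\<And>t. t > 0 \<Longrightarrow> meijer_G m (map (\<lambda>i. - nu m n \<alpha> i) (rev [1..<m + n]) @ [nu m n \<alpha> 0]) t =
            c * of_real (F 0 (scale * t powr (1 / real m)))"
    "\<And>t. t > 0 \<Longrightarrow> meijer_G n (map (nu m n \<alpha>) [0..<m + n]) t =
            d * of_real (G 0 (scale * t powr (1 / real m)))"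
proof -
  have "m > 0" "n > 0" using m n by auto
  obtain Dm :: complex where Dm: "Dm \<noteq> 0" "\<And>z. (\<Prod>j<m. rGamma (z + of_nat j / of_nat m)) =
      Dm * exp (of_nat m * z * of_real (ln (real m))) * rGamma (of_nat m * z)"
    by (rule rGamma_multiplication[OF \<open>m > 0\<close>]) (rule that)
  obtain Dn :: complex where Dn: "Dn \<noteq> 0" "\<And>z. (\<Prod>j<n. rGamma (z + of_nat j / of_nat n)) =
      Dn * exp (of_nat n * z * of_real (ln (real n))) * rGamma (of_nat n * z)"
    by (rule rGamma_multiplication[OF \<open>n > 0\<close>]) (rule that)
  have GammaProd: "(\<Prod>j\<in>A. Gamma (f j)) = inverse (\<Prod>j\<in>A. rGamma (f j))" for A and f :: "nat \<Rightarrow> complex"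
    by (simp add: Gamma_def prod_inversef[symmetric] o_def)
  have complex_powr: "complex_of_real r powr z = exp (z * of_real (ln r))" if "r > 0" for r z
    using that by (simp add: powr_def Ln_of_real)
  \<comment> \<open>Reduces the comparison of integrands to an identity of exponentials:
    \<open>E1\<close> and \<open>E2\<close> come from the multiplication theorem, \<open>E3\<close>
    is the power of t, \<open>E5\<close> the power of \<open>w\<close>, and \<open>E4\<close> a
    constant.\<close>
  have combine: "inverse (D * E1 * r) * (D' * E2 * r') * E3 = D' / D * E4 * (inverse r * r' * E5)"
    if "inverse E1 * E2 * E3 = E4 * E5" for D D' E1 E2 E3 E4 E5 r r' :: complex
  proof -
    have "inverse (D * E1 * r) * (D' * E2 * r') * E3 = D' / D * (inverse E1 * E2 * E3) * (inverse r * r')"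
      by (simp only: divide_inverse inverse_mult_distrib mult_ac)
    then show ?thesis unfolding that by (simp only: mult_ac)
  qed
  \<comment> \<open>The exponentials in \<open>ef\<close> and \<open>eg\<close> are the parts of the
    exponents that are free of the integration variable. The division by m or n below is the factor
    1/p of the residues.\<close>
  define ef where "ef = Dn / Dm * exp (of_real ((real m - \<alpha> - 1) * ln (real m) + real n * ln (real n)))"
  define eg where "eg = Dm / Dn * exp (of_real ((\<alpha> + 1) * ln (real m)))"
  show thesis
  proof (rule that[of "ef / of_nat m" "eg / of_nat n"])
    have "ef * eg = exp (of_real ((real m - \<alpha> - 1) * ln (real m) + real n * ln (real n)) + of_real ((\<alpha> + 1) * ln (real m)))"
      using Dm(1) Dn(1) by (simp add: ef_def eg_def exp_add)
    also have "\<dots> = of_real (exp (real m * ln (real m) + real n * ln (real n)))"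
      by (simp add: algebra_simps flip: exp_of_real)
    also have "exp (real m * ln (real m) + real n * ln (real n)) = real m ^ m * real n ^ n"
      using m n by (simp add: exp_add exp_of_nat_mult)
    finally have "ef * eg = of_real (real m ^ m * real n ^ n)" .
    moreover have "real m ^ m = real m * real m ^ (m - 1)" "real n ^ n = real n * real n ^ (n - 1)"
      using m n by (simp_all add: power_eq_if)
    ultimately show "ef / of_nat m * (eg / of_nat n) = of_real (real m ^ (m - 1) * real n ^ (n - 1))"
      using m n by simp
  next
    fix t :: real assume t: "t > 0"
    define s where "s = scale * t powr (1 / real m)"
    have s: "s > 0" using scale_pos t by (simp add: s_def)
    interpret gamma_quotient 0 "real n" "\<alpha> + 1" "real m" "s powr real m"
      using m n s by unfold_locales auto
    let ?bs = "map (nu m n \<alpha>) [0..<m + n]"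
    have "meijer_G n ?bs t = eg * of_real ((s powr real m) powr (0 / real n) *
         wright_J (\<alpha> + 1 + real m * 0 / real n) (real m / real n) ((s powr real m) powr (1 / real n)) / real n)"
    proof (rule meijer_G_eq_wright_J)
      fix u :: complex
      have 1: "(\<Prod>j<n. Gamma (of_real (?bs ! j) + u)) = (\<Prod>j<n. Gamma (u + of_nat j / of_nat n))"
        using n by (intro prod.cong) (auto simp: nu_def add.commute)
      have 2: "(\<Prod>j=n..<length ?bs. rGamma (1 - of_real (?bs ! j) - u)) =
          (\<Prod>l<m. rGamma ((of_real ((\<alpha> + 1) / real m) - u) + of_nat l / of_nat m))"
      proof -
        have "(\<Prod>j=n..<length ?bs. rGamma (1 - of_real (?bs ! j) - u)) =
          (\<Prod>j=0..<m. rGamma (1 - complex_of_real (?bs ! (j + n)) - u))"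
          using prod.shift_bounds_nat_ivl[of "\<lambda>j. rGamma (1 - complex_of_real (?bs ! j) - u)" 0 n m] by simp
        also have "\<dots> = (\<Prod>l<m. rGamma ((of_real ((\<alpha> + 1) / real m) - u) + of_nat l / of_nat m))"
          unfolding atLeast0LessThan using m n
          by (intro prod.cong) (auto simp: nu_def add_divide_distrib algebra_simps)
        finally show ?thesis .
      qed
      have m_eq: "of_nat m * (of_real ((\<alpha> + 1) / real m) - u) = of_real (\<alpha> + 1) - of_real (real m) * u"
        using m by (simp add: field_simps)
      have n_eq: "of_nat n * u = of_real 0 + of_real (real n) * u"
        by simp
      have w_powr: "complex_of_real (s powr real m) powr - u =
          exp (- u * of_real (real m * ln (real m) + real n * ln (real n) + ln t))"
        unfolding ln_scale[OF t, folded s_def, symmetric] using s by (intro complex_powr) simp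
      have t_powr: "complex_of_real t powr - u = exp (- u * of_real (ln t))"
        by (rule complex_powr[OF t])
      show "meijer_G_integrand n ?bs t u = eg * h u"
        unfolding meijer_G_integrand_def 1 2
        unfolding GammaProd Dm(2) Dn(2) m_eq n_eq
        unfolding h_def eg_def w_powr t_powr Gamma_def
        by (rule combine) (simp add: algebra_simps flip: exp_add exp_minus)
    next
      show "Max ((\<lambda>j. - ?bs ! j) ` {..<n}) = - 0 / real n"
      proof (rule Max_eqI)
        show "y \<le> - 0 / real n" if "y \<in> (\<lambda>j. - ?bs ! j) ` {..<n}" for y
          using that n by (auto simp: nu_def)
        show "- 0 / real n \<in> (\<lambda>j. - ?bs ! j) ` {..<n}"
          using n by (auto intro!: image_eqI[of _ _ 0] simp: nu_def)
      qed auto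
    qed
    also have "\<dots> = eg * of_real (G 0 s / real n)"
      unfolding wright_G_eq[OF s] ..
    finally show "meijer_G n ?bs t = eg / of_nat n * of_real (G 0 (scale * t powr (1 / real m)))"
      by (simp add: s_def)
  next
    fix t :: real assume t: "t > 0"
    define s where "s = scale * t powr (1 / real m)"
    have s: "s > 0" using scale_pos t by (simp add: s_def)
    interpret gamma_quotient "\<alpha> + 1 - real m" "real m" "real n" "real n" "s powr real m"
      using m n s by unfold_locales auto
    let ?bs = "map (\<lambda>i. - nu m n \<alpha> i) (rev [1..<m + n]) @ [nu m n \<alpha> 0]"
    \<comment> \<open>The last entry is nu_0 without a minus sign; as nu_0 = 0, it obeys the same
      formula.\<close>
    have bs_nth: "?bs ! j = - nu m n \<alpha> (m + n - Suc j)" if "j < m + n" for j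
      using that by (auto simp: nth_append rev_nth nu_def not_less)
    have len: "length ?bs = m + n" using n by simp
    have "meijer_G m ?bs t = ef * of_real ((s powr real m) powr ((\<alpha> + 1 - real m) / real m) *
         wright_J (real n + real n * (\<alpha> + 1 - real m) / real m) (real n / real m) ((s powr real m) powr (1 / real m)) / real m)"
    proof (rule meijer_G_eq_wright_J)
      fix u :: complex
      let ?z = "u - 1 + of_real ((\<alpha> + 1) / real m)"
      have "(\<Prod>j<m. Gamma (of_real (?bs ! j) + u)) = (\<Prod>j<m. Gamma (?z + of_nat (m - Suc j) / of_nat m))"
      proof (intro prod.cong refl)
        fix j assume "j \<in> {..<m}"
        then have bs_j: "?bs ! j = (\<alpha> + 1) / real m - 1 + real (m - Suc j) / real m"
          using n by (subst bs_nth) (auto simp: nu_def of_nat_diff add_divide_distrib diff_divide_distrib)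
        show "Gamma (of_real (?bs ! j) + u) = Gamma (?z + of_nat (m - Suc j) / of_nat m)"
          unfolding bs_j by (simp add: algebra_simps)
      qed
      also have "\<dots> = (\<Prod>l<m. Gamma (?z + of_nat l / of_nat m))"
        by (rule prod.nat_diff_reindex)
      finally have 1: "(\<Prod>j<m. Gamma (of_real (?bs ! j) + u)) = (\<Prod>l<m. Gamma (?z + of_nat l / of_nat m))" .
      have "(\<Prod>j=m..<length ?bs. rGamma (1 - of_real (?bs ! j) - u)) =
          (\<Prod>j=0..<n. rGamma (1 - complex_of_real (?bs ! (j + m)) - u))"
        using prod.shift_bounds_nat_ivl[of "\<lambda>j. rGamma (1 - complex_of_real (?bs ! j) - u)" 0 m n]
        unfolding len by (simp add: add.commute)
      also have "\<dots> = (\<Prod>l<n. rGamma ((1 - u) + of_nat (n - Suc l) / of_nat n))"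
        unfolding atLeast0LessThan
      proof (intro prod.cong refl)
        fix j assume "j \<in> {..<n}"
        then have "?bs ! (j + m) = - nu m n \<alpha> (n - Suc j)"
          by (subst bs_nth) auto
        moreover have "n - Suc j \<le> n - 1" by (intro diff_le_mono2) simp
        then have "nu m n \<alpha> (n - Suc j) = real (n - Suc j) / real n"
          by (auto simp: nu_def)
        ultimately have bs_j: "?bs ! (j + m) = - (real (n - Suc j) / real n)" by simp
        show "rGamma (1 - complex_of_real (?bs ! (j + m)) - u) = rGamma ((1 - u) + of_nat (n - Suc j) / of_nat n)"
          unfolding bs_j by (simp add: algebra_simps)
      qed
      also have "\<dots> = (\<Prod>l<n. rGamma ((1 - u) + of_nat l / of_nat n))"
        by (rule prod.nat_diff_reindex)
      finally have 2: "(\<Prod>j=m..<length ?bs. rGamma (1 - of_real (?bs ! j) - u)) =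
          (\<Prod>l<n. rGamma ((1 - u) + of_nat l / of_nat n))" .
      have m_eq: "of_nat m * ?z = of_real (\<alpha> + 1 - real m) + of_real (real m) * u"
        using m by (simp add: field_simps)
      have n_eq: "of_nat n * (1 - u) = of_real (real n) - of_real (real n) * u"
        by (simp add: algebra_simps)
      have w_powr: "complex_of_real (s powr real m) powr - u =
          exp (- u * of_real (real m * ln (real m) + real n * ln (real n) + ln t))"
        unfolding ln_scale[OF t, folded s_def, symmetric] using s by (intro complex_powr) simp
      have t_powr: "complex_of_real t powr - u = exp (- u * of_real (ln t))"
        by (rule complex_powr[OF t])
      show "meijer_G_integrand m ?bs t u = ef * h u"
        unfolding meijer_G_integrand_def 1 2
        unfolding GammaProd Dm(2) Dn(2) m_eq n_eq
        unfolding h_def ef_def w_powr t_powr Gamma_def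
        by (rule combine) (simp add: algebra_simps flip: exp_add exp_minus)
    next
      have "(\<lambda>j. - ?bs ! j) ` {..<m} = (\<lambda>j. nu m n \<alpha> (m + n - Suc j)) ` {..<m}"
        by (intro image_cong refl) (simp only: bs_nth lessThan_iff trans_less_add1 minus_minus)
      \<comment> \<open>The nu_i decrease from i = n on, so the maximum is nu_n, which the reversed
        list has at the position m - 1.\<close>
      moreover have "Max ((\<lambda>j. nu m n \<alpha> (m + n - Suc j)) ` {..<m}) = - (\<alpha> + 1 - real m) / real m"
      proof (rule Max_eqI)
        show "y \<le> - (\<alpha> + 1 - real m) / real m" if "y \<in> (\<lambda>j. nu m n \<alpha> (m + n - Suc j)) ` {..<m}" for y
          using that m n by (auto simp: nu_def of_nat_diff field_simps)
        show "- (\<alpha> + 1 - real m) / real m \<in> (\<lambda>j. nu m n \<alpha> (m + n - Suc j)) ` {..<m}"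
          using m n by (auto intro!: image_eqI[of _ _ "m - 1"] simp: nu_def of_nat_diff field_simps)
      qed auto
      ultimately show "Max ((\<lambda>j. - ?bs ! j) ` {..<m}) = - (\<alpha> + 1 - real m) / real m" by simp
    qed
    also have "\<dots> = ef * of_real (F 0 s / real m)"
      unfolding wright_F_eq[OF s] ..
    finally show "meijer_G m ?bs t = ef / of_nat m * of_real (F 0 (scale * t powr (1 / real m)))"
      by (simp add: s_def)
  qed
qed

text \<open>Both sides are m^(m-1) n^(n-1-n/m). This matches the constant of the two G-functions
  with the one from the rescaled kernel.\<close>

lemma scale_powr_factor:
  "real m ^ (m - 1) * real n ^ (n - 1) / real n powr (real n / real m) = scale ^ (m - 1) / real n"
proof -
  have "(real n powr (real n / real m)) ^ (m - 1) * real n powr (real n / real m) = real n * real n ^ (n - 1)"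
  proof -
    have "(real n powr (real n / real m)) ^ (m - 1) * real n powr (real n / real m) = (real n powr (real n / real m)) ^ m"
      using m by (simp add: power_eq_if)
    also have "\<dots> = real n ^ n"
      using m n by (simp add: powr_powr flip: powr_realpow)
    finally show ?thesis using n by (simp add: power_eq_if)
  qed
  then show ?thesis
    using n by (simp add: scale_def power_mult_distrib field_simps)
qed

end

theorem theorem1p1:
  fixes m n :: nat and \<alpha> x y :: real
  assumes "m \<ge> 1" and "n \<ge> 1" and "gcd m n = 1"
    and "\<alpha> > real m - 1 - real m / real n"
    and "x > 0" and "y > 0" and "x \<noteq> y"
  shows "wright_kernel \<alpha> (real m / real n) x y =
           real m ^ m * real n ^ (n - 1) * x ^ (m - 1) *
           (concomitant m n \<alpha>
              (\<lambda>t. t powr (\<alpha> + 1 - real m) *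
                   wright_J ((\<alpha> + 1) * real n / real m) (real n / real m) t)
              (\<lambda>t. wright_J (\<alpha> + 1) (real m / real n) (t powr (real m / real n)))
              x y
            / (x ^ m - y ^ m))
       \<and> complex_of_real
           (wright_kernel \<alpha> (real m / real n)
              (real m * real n powr (real n / real m) * x powr (1 / real m))
              (real m * real n powr (real n / real m) * y powr (1 / real m))) =
           of_real (x powr (1 - 1 / real m) / real n powr (real n / real m)) *
           (concomitant_tilde m n \<alpha>
              (meijer_G m (map (\<lambda>i. - nu m n \<alpha> i) (rev [1..<m + n]) @ [nu m n \<alpha> 0]))
              (meijer_G n (map (nu m n \<alpha>) [0..<m + n]))
              x y
            / of_real (x - y))
       \<and> wright_kernel \<alpha> (real m / real n)
           (real m * real n powr (real n / real m) * x powr (1 / real m))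
           (real m * real n powr (real n / real m) * y powr (1 / real m)) =
           real m powr \<alpha> * real n powr (real n * \<alpha> / real m - 1) * x powr (1 - 1 / real m) *
           (concomitant_tilde m n \<alpha>
              (\<lambda>t. t powr ((\<alpha> + 1) / real m - 1) *
                   wright_J ((\<alpha> + 1) * real n / real m) (real n / real m)
                     (real m * real n powr (real n / real m) * t powr (1 / real m)))
              (\<lambda>t. wright_J (\<alpha> + 1) (real m / real n)
                     (real m powr (real m / real n) * real n * t powr (1 / real n)))
              x y
            / (x - y))"
proof (intro conjI)
  interpret wright_parameters m n \<alpha>
    using assms by unfold_locales
  let ?X = "scale * x powr (1 / real m)" and ?Y = "scale * y powr (1 / real m)"
  let ?B = "(- 1) ^ (n + 1) * bilinear ?X ?Y"
  show "wright_kernel \<alpha> (real m / real n) x y =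
           real m ^ m * real n ^ (n - 1) * x ^ (m - 1) *
           (concomitant m n \<alpha>
              (\<lambda>t. t powr (\<alpha> + 1 - real m) *
                   wright_J ((\<alpha> + 1) * real n / real m) (real n / real m) t)
              (\<lambda>t. wright_J (\<alpha> + 1) (real m / real n) (t powr (real m / real n)))
              x y
            / (x ^ m - y ^ m))"
    unfolding concomitant_eq_bilinear[OF assms(5,6)] by (rule wright_kernel_eq_bilinear[OF assms(5-7)])
  have kernel: "wright_kernel \<alpha> (real m / real n) ?X ?Y =
      scale ^ (m - 1) * x powr (1 - 1 / real m) / real n * (?B / (x - y))"
    by (rule wright_kernel_scale[OF assms(5-7)])
  obtain c d :: complex where cd: "c * d = of_real (real m ^ (m - 1) * real n ^ (n - 1))"
    and G: "\<And>t. t > 0 \<Longrightarrow> meijer_G m (map (\<lambda>i. - nu m n \<alpha> i) (rev [1..<m + n]) @ [nu m n \<alpha> 0]) t =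
            c * of_real (F 0 (scale * t powr (1 / real m)))"
    "\<And>t. t > 0 \<Longrightarrow> meijer_G n (map (nu m n \<alpha>) [0..<m + n]) t =
            d * of_real (G 0 (scale * t powr (1 / real m)))"
    using meijer_G_eq_F_G by metis
  show "complex_of_real
           (wright_kernel \<alpha> (real m / real n)
              (real m * real n powr (real n / real m) * x powr (1 / real m))
              (real m * real n powr (real n / real m) * y powr (1 / real m))) =
           of_real (x powr (1 - 1 / real m) / real n powr (real n / real m)) *
           (concomitant_tilde m n \<alpha>
              (meijer_G m (map (\<lambda>i. - nu m n \<alpha> i) (rev [1..<m + n]) @ [nu m n \<alpha> 0]))
              (meijer_G n (map (nu m n \<alpha>) [0..<m + n]))
              x y
            / of_real (x - y))"
  proof -
    have "x powr (1 - 1 / real m) / real n powr (real n / real m) * (real m ^ (m - 1) * real n ^ (n - 1) * ?B / (x - y)) =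
        real m ^ (m - 1) * real n ^ (n - 1) / real n powr (real n / real m) * x powr (1 - 1 / real m) * (?B / (x - y))"
      by simp
    also have "\<dots> = scale ^ (m - 1) * x powr (1 - 1 / real m) / real n * (?B / (x - y))"
      unfolding scale_powr_factor by simp
    finally have "wright_kernel \<alpha> (real m / real n) ?X ?Y = x powr (1 - 1 / real m) / real n powr (real n / real m) *
         (real m ^ (m - 1) * real n ^ (n - 1) * ?B / (x - y))"
      unfolding kernel by (rule sym)
    moreover have "concomitant_tilde m n \<alpha>
              (meijer_G m (map (\<lambda>i. - nu m n \<alpha> i) (rev [1..<m + n]) @ [nu m n \<alpha> 0]))
              (meijer_G n (map (nu m n \<alpha>) [0..<m + n])) x y =
        c * d * of_real ?B"
      by (rule concomitant_tilde_eq_bilinear[OF assms(5,6) scale_pos G])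
    ultimately show ?thesis
      unfolding scale_def[symmetric] by (simp only: cd of_real_mult of_real_divide)
  qed
  show "wright_kernel \<alpha> (real m / real n)
           (real m * real n powr (real n / real m) * x powr (1 / real m))
           (real m * real n powr (real n / real m) * y powr (1 / real m)) =
           real m powr \<alpha> * real n powr (real n * \<alpha> / real m - 1) * x powr (1 - 1 / real m) *
           (concomitant_tilde m n \<alpha>
              (\<lambda>t. t powr ((\<alpha> + 1) / real m - 1) *
                   wright_J ((\<alpha> + 1) * real n / real m) (real n / real m)
                     (real m * real n powr (real n / real m) * t powr (1 / real m)))
              (\<lambda>t. wright_J (\<alpha> + 1) (real m / real n)
                     (real m powr (real m / real n) * real n * t powr (1 / real n)))
              x y
            / (x - y))"
  proof -
    \<comment> \<open>Cancels the constant power of \<open>scale\<close> that \<open>F 0\<close>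
      carries at the rescaled argument, because the first function here has a power of t alone in
      front.\<close>
    define c where "c = 1 / scale powr (\<alpha> + 1 - real m)"
    have f: "t powr ((\<alpha> + 1) / real m - 1) * wright_J ((\<alpha> + 1) * real n / real m) (real n / real m)
          (real m * real n powr (real n / real m) * t powr (1 / real m)) =
        c * of_real (F 0 (scale * t powr (1 / real m)))" if t: "t > 0" for t
    proof -
      have "1 / real m * (\<alpha> + 1 - real m) = (\<alpha> + 1) / real m - 1"
        using m by (simp add: field_simps)
      then have "c * (scale * t powr (1 / real m)) powr (\<alpha> + 1 - real m) = t powr ((\<alpha> + 1) / real m - 1)"
        using scale_pos t by (simp add: c_def powr_mult powr_powr)
      then show ?thesis
        using F_0_eq[of "scale * t powr (1 / real m)"] scale_pos t
        by (simp add: mult.assoc[symmetric] flip: scale_def)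
    qed
    have g: "wright_J (\<alpha> + 1) (real m / real n) (real m powr (real m / real n) * real n * t powr (1 / real n)) =
        1 * of_real (G 0 (scale * t powr (1 / real m)))" if t: "t > 0" for t
    proof -
      have "(scale * t powr (1 / real m)) powr (real m / real n) = real m powr (real m / real n) * real n * t powr (1 / real n)"
        using m n t by (simp add: scale_def powr_mult powr_powr)
      then show ?thesis
        using G_0_eq[of "scale * t powr (1 / real m)"] scale_pos t by simp
    qed
    \<comment> \<open>The exponent m - 1 splits as \<alpha> - (\<alpha> + 1 - m): the second part is
      the constant \<open>c\<close>, the first gives the powers of m and n in front.\<close>
    have "scale ^ (m - 1) = scale powr (real m - 1)"
      using scale_pos m by (simp add: of_nat_diff flip: powr_realpow)
    also have "\<dots> = scale powr \<alpha> * c"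
      using scale_pos by (simp add: c_def flip: powr_diff)
    also have "scale powr \<alpha> = real m powr \<alpha> * real n powr (real n * \<alpha> / real m)"
      using m n by (simp add: scale_def powr_mult powr_powr)
    also have "real n powr (real n * \<alpha> / real m) = real n powr (real n * \<alpha> / real m - 1) * real n"
      using n by (simp add: powr_diff)
    finally have factor: "scale ^ (m - 1) / real n = real m powr \<alpha> * real n powr (real n * \<alpha> / real m - 1) * c"
      using n by simp
    have "wright_kernel \<alpha> (real m / real n) ?X ?Y =
        scale ^ (m - 1) / real n * x powr (1 - 1 / real m) * (?B / (x - y))"
      unfolding kernel by simp
    then have "wright_kernel \<alpha> (real m / real n) ?X ?Y =
        real m powr \<alpha> * real n powr (real n * \<alpha> / real m - 1) * x powr (1 - 1 / real m) * (c * ?B / (x - y))"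
      unfolding factor by simp
    moreover have "concomitant_tilde m n \<alpha>
              (\<lambda>t. t powr ((\<alpha> + 1) / real m - 1) *
                   wright_J ((\<alpha> + 1) * real n / real m) (real n / real m)
                     (real m * real n powr (real n / real m) * t powr (1 / real m)))
              (\<lambda>t. wright_J (\<alpha> + 1) (real m / real n)
                     (real m powr (real m / real n) * real n * t powr (1 / real n))) x y =
        c * 1 * of_real ?B"
      by (rule concomitant_tilde_eq_bilinear[OF assms(5,6) scale_pos f g])
    ultimately show ?thesis
      unfolding scale_def[symmetric] by (simp only: of_real_eq_id id_apply mult_1_right)
  qed
qed

end
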